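(* Let $0<s<1$, $q>0$ and $z\in\mathbb{C}\setminus\mathbb{R}$, and consider on the real axis the external field $$Q(x)=-\frac{q}{|x-z|^{s}},\qquad x\in\mathbb{R}.$$ Consider the Gauss variational problem of minimizing the weighted Riesz $s$-energy $$I_Q(\nu)=\iint\frac{d\nu(x)\,d\nu(y)}{|x-y|^{s}}+2\int Q(x)\,d\nu(x)$$ over all Borel probability measures $\nu$ supported on $\mathbb{R}$. Then: (1) if $q>1$, there exists a unique equilibrium measure $\mu_Q$ (minimizer), and its support $S_Q=\operatorname{supp}\mu_Q$ is a compact interval of the real axis; (2) if $q<1$, the equilibrium measure does not exist.
   Context: For a measure $\sigma$ on $\mathbb{R}$, its Riesz $s$-potential is $U_s^{\sigma}(x)=\int|x-y|^{-s}\,d\sigma(y)$. The equilibrium measure $\mu_Q$ (when it exists) is the minimizer of $I_Q$ among probability measures on $\mathbb{R}$; it is characterized by the Frostman conditions: for some constant $F_Q$, $U_s^{\mu_Q}(x)+Q(x)\ge F_Q$ quasi-everywhere on $\mathbb{R}$ (i.e. outside a set of zero Riesz $s$-capacity) and $U_s^{\mu_Q}(x)+Q(x)\le F_Q$ everywhere on $\operatorname{supp}\mu_Q$. *)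

theory Defs
  imports "HOL-Probability.Probability"
begin

definition riesz_kernel :: "real \<Rightarrow> real \<Rightarrow> real \<Rightarrow> ennreal" where
  "riesz_kernel s x y = (if x = y then \<infinity> else ennreal (\<bar>x - y\<bar> powr (- s)))"

definition riesz_energy :: "real \<Rightarrow> real measure \<Rightarrow> ennreal" where
  "riesz_energy s \<nu> = (\<integral>\<^sup>+ x. (\<integral>\<^sup>+ y. riesz_kernel s x y \<partial>\<nu>) \<partial>\<nu>)"

definition weighted_energy :: "real \<Rightarrow> (real \<Rightarrow> real) \<Rightarrow> real measure \<Rightarrow> ereal" where
  "weighted_energy s Q \<nu> = enn2ereal (riesz_energy s \<nu>) + ereal (2 * (\<integral> x. Q x \<partial>\<nu>))"

definition real_prob_measure :: "real measure \<Rightarrow> bool" where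
  "real_prob_measure \<nu> \<longleftrightarrow> prob_space \<nu> \<and> sets \<nu> = sets borel"

definition is_equilibrium_measure :: "real \<Rightarrow> (real \<Rightarrow> real) \<Rightarrow> real measure \<Rightarrow> bool" where
  "is_equilibrium_measure s Q \<mu> \<longleftrightarrow> real_prob_measure \<mu> \<and>
     (\<forall>\<nu>. real_prob_measure \<nu> \<longrightarrow> weighted_energy s Q \<mu> \<le> weighted_energy s Q \<nu>)"

definition measure_support :: "real measure \<Rightarrow> real set" where
  "measure_support \<mu> = {x. \<forall>e>0. emeasure \<mu> (ball x e) \<noteq> 0}"

definition field_Q :: "real \<Rightarrow> real \<Rightarrow> complex \<Rightarrow> real \<Rightarrow> real" where
  "field_Q s q z x = - q / (cmod (complex_of_real x - z) powr s)"

end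

theory Submission
  imports Defs
begin

text \<open>
  The kernel is a positive superposition of products of indicators of intervals, so the mutual energy of
  two measures is a weighted \<open>L\<^sup>2\<close> inner product of the functions \<open>(u, v) \<mapsto> \<mu> {u<..v}\<close>. Hence the energy is
  strictly convex and, by Fatou's lemma, lower semicontinuous along Helly subsequences.
  On the line the field is \<open>- q\<close> times the potential of the balayage \<open>\<sigma>\<close> of the unit mass at \<open>z\<close>,
  a probability measure with density proportional to \<open>\<bar>y - z\<bar>\<close> to the power \<open>s - 2\<close>; up to a constant,
  \<open>I\<^sub>Q \<nu>\<close> is therefore the squared energy distance from \<open>\<nu>\<close> to \<open>q \<sigma>\<close>. Mass may be spread out at infinity at no
  cost, so the infimum over probability measures is the infimum over subprobability measures. If \<open>q < 1\<close>
  it could only be attained at \<open>q \<sigma>\<close>, which has mass \<open>q\<close>. If \<open>q > 1\<close>, a vague limit of a minimizing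
  sequence cannot lose mass, since moving it towards \<open>q \<sigma>\<close> would lower the energy.
  Moreover the Frostman constant is negative for \<open>q > 1\<close>. As the field vanishes at infinity, this bounds the support.
  Divided by the field and expressed in the angle at which \<open>z\<close> sees \<open>x\<close>, the potential plus a positive
  constant is strictly convex on a gap of the support, which contradicts the Frostman conditions.
\<close>

lemma finite_borel_measureI:
  "finite_measure M \<Longrightarrow> sets M = sets borel \<Longrightarrow> finite_borel_measure M"
  by (simp add: finite_borel_measure_def finite_borel_measure_axioms_def)

subsection \<open>The Riesz kernel\<close>

locale riesz =
  fixes s :: real
  assumes s_pos: "0 < s" and s_less: "s < 1"
begin

text \<open>The kernel is a superposition of products of indicators of half-open intervals:
  \<open>\<bar>x - y\<bar>\<^sup>-\<^sup>s = \<integral>\<integral> weight u v \<cdot> 1\<^bsub>(u,v]\<^esub>(x) \<cdot> 1\<^bsub>(u,v]\<^esub>(y) du dv\<close>.\<close>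

definition weight :: "real \<Rightarrow> real \<Rightarrow> ennreal" where
  "weight u v = (if u < v then ennreal (s * (s + 1) * (v - u) powr (- s - 2)) else 0)"

lemma measurable_weight [measurable (raw)]:
  assumes [measurable]: "f \<in> borel_measurable M" "g \<in> borel_measurable M"
  shows "(\<lambda>x. weight (f x) (g x)) \<in> borel_measurable M"
  unfolding weight_def by measurable

text \<open>The exponent \<open>c\<close> is a separate variable tied to \<open>b\<close> by an
  equation, so that the rule applies to exponents such as \<open>- s - 2\<close> in whatever form
  they occur.\<close>

lemma nn_integral_powr_tail:
  fixes a b d :: real
  assumes "0 < d" "0 \<le> a" "0 < b" "c = - b - 1"
  shows "(\<integral>\<^sup>+t. ennreal (a * b * (t - u) powr c) * indicator {u + d..} t \<partial>lborel) = ennreal (a * d powr (- b))"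
proof -
  have "(\<integral>\<^sup>+t. ennreal (a * b * (t - u) powr c) * indicator {u + d..} t \<partial>lborel)
      = ennreal (0 - (- a * (u + d - u) powr (- b)))"
  proof (rule nn_integral_FTC_atLeast)
    show "((\<lambda>t. - a * (t - u) powr (- b)) \<longlongrightarrow> 0) at_top"
      using assms by real_asymp
  next
    fix t assume "u + d \<le> t"
    then show "((\<lambda>t. - a * (t - u) powr (- b)) has_real_derivative a * b * (t - u) powr c) (at t)"
      using assms by (auto intro!: derivative_eq_intros)
  qed (use assms in auto)
  then show ?thesis by simp
qed

text \<open>This is the outer integral of the kernel decomposition, with \<open>d\<close> the
  distance between the two points. The case \<open>d = 0\<close> reproduces the value infinity of
  the kernel on the diagonal.\<close>

lemma nn_integral_powr_open_tail:
  fixes d :: real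
  assumes "0 \<le> d"
  shows "(\<integral>\<^sup>+t. ennreal (s * t powr (- s - 1)) * indicator {d<..} t \<partial>lborel)
    = (if d = 0 then \<infinity> else ennreal (d powr (- s)))"
proof -
  have tail: "(\<integral>\<^sup>+t. ennreal (s * t powr (- s - 1)) * indicator {e..} t \<partial>lborel) = ennreal (e powr (- s))"
    if "0 < e" for e
    using nn_integral_powr_tail[of e 1 s "- s - 1" 0] that s_pos by simp
  show ?thesis
  proof (cases "d = 0")
    case False
    have "(\<integral>\<^sup>+t. ennreal (s * t powr (- s - 1)) * indicator {d<..} t \<partial>lborel)
        = (\<integral>\<^sup>+t. ennreal (s * t powr (- s - 1)) * indicator {d..} t \<partial>lborel)"
      using AE_lborel_singleton[of d] by (intro nn_integral_cong_AE) (auto simp: indicator_def elim!: eventually_mono)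
    then show ?thesis using False assms tail by simp
  next
    case True
    let ?I = "\<integral>\<^sup>+t. ennreal (s * t powr (- s - 1)) * indicator {d<..} t \<partial>lborel"
    have *: "of_nat n \<le> ?I" if "n > 0" for n :: nat
    proof -
      \<comment> \<open>\<open>e\<close> is chosen so that the tail starting at \<open>e\<close>
        contributes exactly \<open>n\<close>.\<close>
      define e where "e = real n powr (- 1 / s)"
      have "e > 0" "e powr (- s) = n" using that s_pos by (auto simp: e_def powr_powr)
      then have "of_nat n = ennreal (e powr (- s))" by (simp add: ennreal_of_nat_eq_real_of_nat)
      also have "\<dots> = (\<integral>\<^sup>+t. ennreal (s * t powr (- s - 1)) * indicator {e..} t \<partial>lborel)"
        using tail \<open>e > 0\<close> by simp
      also have "\<dots> \<le> ?I"
        using True \<open>e > 0\<close> by (intro nn_integral_mono) (auto simp: indicator_def)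
      finally show ?thesis .
    qed
    have "?I = \<infinity>"
    proof (rule ccontr)
      assume "?I \<noteq> \<infinity>"
      then obtain n :: nat where "?I < of_nat n" using ennreal_Ex_less_of_nat by (auto simp: less_top)
      moreover from this have "n > 0" by (cases n) auto
      ultimately show False using * by (meson not_le)
    qed
    then show ?thesis using True by simp
  qed
qed

text \<open>With \<open>p\<close> the smaller and \<open>r\<close> the larger point, the two
  indicators say \<open>u < p\<close> and \<open>r \<le> v\<close>. Integrating over
  \<open>v\<close> leaves \<open>s * (r - u) powr (- s - 1)\<close> for \<open>u < p\<close>; the
  reflection \<open>u = r - t\<close> then turns the outer integral into an open tail from
  \<open>r - p\<close>.\<close>

lemma riesz_kernel_eq_nn_integral:
  "riesz_kernel s x y
    = (\<integral>\<^sup>+u. \<integral>\<^sup>+v. weight u v * (indicator {u<..v} x * indicator {u<..v} y) \<partial>lborel \<partial>lborel)"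
proof -
  define p r where "p = min x y" and "r = max x y"
  have "p \<le> r" by (simp add: p_def r_def)
  have inner: "(\<integral>\<^sup>+v. weight u v * (indicator {u<..v} x * indicator {u<..v} y) \<partial>lborel)
      = ennreal (s * (r - u) powr (- s - 1)) * indicator {..<p} u" for u
  proof (cases "u < p")
    case True
    have "(\<integral>\<^sup>+v. weight u v * (indicator {u<..v} x * indicator {u<..v} y) \<partial>lborel)
      = (\<integral>\<^sup>+v. ennreal (s * (s + 1) * (v - u) powr (- s - 2)) * indicator {u + (r - u)..} v \<partial>lborel)"
      using True by (intro nn_integral_cong) (auto simp: indicator_def weight_def p_def r_def)
    also have "\<dots> = ennreal (s * (r - u) powr (- (s + 1)))"
      using True s_pos \<open>p \<le> r\<close> by (intro nn_integral_powr_tail) auto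
    finally show ?thesis using True by simp
  next
    case False
    then have "\<not> (u < x \<and> u < y)" by (auto simp: p_def)
    then have "weight u v * (indicator {u<..v} x * indicator {u<..v} y) = 0" for v
      by (auto simp: indicator_def)
    then show ?thesis using False by (simp only: nn_integral_const) simp
  qed
  have "(\<integral>\<^sup>+u. ennreal (s * (r - u) powr (- s - 1)) * indicator {..<p} u \<partial>lborel)
     = (\<integral>\<^sup>+t. ennreal (s * t powr (- s - 1)) * indicator {r - p<..} t \<partial>lborel)"
    by (subst nn_integral_real_affine[of _ "-1" r]) (auto simp: indicator_def intro!: nn_integral_cong)
  also have "\<dots> = riesz_kernel s x y"
    using \<open>p \<le> r\<close> by (subst nn_integral_powr_open_tail)
      (auto simp: riesz_kernel_def p_def r_def min_def max_def)
  finally show ?thesis by (simp add: inner)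
qed

lemma measurable_riesz_kernel [measurable (raw)]:
  assumes [measurable]: "f \<in> borel_measurable M" "g \<in> borel_measurable M"
  shows "(\<lambda>x. riesz_kernel s (f x) (g x)) \<in> borel_measurable M"
  unfolding riesz_kernel_def by measurable

definition potential :: "real measure \<Rightarrow> real \<Rightarrow> ennreal" where
  "potential \<nu> x = (\<integral>\<^sup>+y. riesz_kernel s x y \<partial>\<nu>)"

definition energy :: "real measure \<Rightarrow> real measure \<Rightarrow> ennreal" where
  "energy \<mu> \<nu> = (\<integral>\<^sup>+x. potential \<nu> x \<partial>\<mu>)"

lemma riesz_energy_eq: "riesz_energy s \<mu> = energy \<mu> \<mu>"
  by (simp add: riesz_energy_def energy_def potential_def)

lemma measurable_potential:
  assumes "finite_borel_measure \<nu>"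
  shows "potential \<nu> \<in> borel_measurable borel"
proof -
  interpret finite_borel_measure \<nu> by fact
  note M_is_borel[measurable_cong]
  show ?thesis unfolding potential_def by measurable
qed

text \<open>Insert the decomposition of the kernel and exchange integrals by Tonelli: the indicator
  of each interval integrates to its measure. The energy becomes a bilinear form in interval masses
  with a nonnegative weight.\<close>

lemma energy_eq_nn_integral:
  assumes "finite_borel_measure \<mu>" "finite_borel_measure \<nu>"
  shows "energy \<mu> \<nu> = (\<integral>\<^sup>+\<omega>. weight (fst \<omega>) (snd \<omega>) * (emeasure \<mu> {fst \<omega><..snd \<omega>} * emeasure \<nu> {fst \<omega><..snd \<omega>})
     \<partial>(lborel \<Otimes>\<^sub>M lborel))"
proof -
  interpret m: finite_borel_measure \<mu> by fact
  interpret n: finite_borel_measure \<nu> by fact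
  note m.M_is_borel[measurable_cong] n.M_is_borel[measurable_cong]
  let ?L = "lborel \<Otimes>\<^sub>M lborel :: (real \<times> real) measure"
  let ?w = "\<lambda>\<omega>. weight (fst \<omega>) (snd \<omega>)"
  let ?I = "\<lambda>(x::real) \<omega>. indicator {fst \<omega><..snd \<omega>} x :: ennreal"
  interpret L: sigma_finite_measure ?L by (simp add: lborel_prod sigma_finite_lborel)
  interpret Ln: pair_sigma_finite \<nu> ?L ..
  interpret Lm: pair_sigma_finite \<mu> ?L ..
  \<comment> \<open>The interval itself depends on the integration variable, so membership is
    written as two inequalities between measurable functions.\<close>
  have I[measurable]: "(\<lambda>x. ?I (f x) (g x)) \<in> borel_measurable N"
    if [measurable]: "f \<in> borel_measurable N" "g \<in> N \<rightarrow>\<^sub>M (borel \<Otimes>\<^sub>M borel)" for f g and N :: "'n measure"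
  proof -
    have [measurable]: "(\<lambda>x. fst (g x)) \<in> borel_measurable N" "(\<lambda>x. snd (g x)) \<in> borel_measurable N"
      using that(2) by (rule measurable_compose[OF _ measurable_fst], rule measurable_compose[OF _ measurable_snd])
    show ?thesis unfolding indicator_def greaterThanAtMost_iff by measurable
  qed
  have pot: "potential \<nu> x = (\<integral>\<^sup>+\<omega>. ?w \<omega> * (?I x \<omega> * emeasure \<nu> {fst \<omega><..snd \<omega>}) \<partial>?L)" for x
  proof -
    have "potential \<nu> x = (\<integral>\<^sup>+y. \<integral>\<^sup>+\<omega>. ?w \<omega> * (?I x \<omega> * ?I y \<omega>) \<partial>?L \<partial>\<nu>)"
      unfolding potential_def riesz_kernel_eq_nn_integral
      by (subst lborel.nn_integral_fst[symmetric]) auto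
    also have "\<dots> = (\<integral>\<^sup>+\<omega>. \<integral>\<^sup>+y. ?w \<omega> * (?I x \<omega> * ?I y \<omega>) \<partial>\<nu> \<partial>?L)"
      by (rule Ln.Fubini'[symmetric]) measurable
    also have "\<dots> = (\<integral>\<^sup>+\<omega>. ?w \<omega> * (?I x \<omega> * emeasure \<nu> {fst \<omega><..snd \<omega>}) \<partial>?L)"
      by (intro nn_integral_cong) (simp add: nn_integral_cmult)
    finally show ?thesis .
  qed
  have [measurable]: "(\<lambda>\<omega>. emeasure \<nu> {fst \<omega><..snd \<omega>}) \<in> borel_measurable ?L"
  proof -
    have "(\<lambda>\<omega>. \<integral>\<^sup>+y. ?I y \<omega> \<partial>\<nu>) \<in> borel_measurable ?L"
      by measurable
    then show ?thesis by simp
  qed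
  have "energy \<mu> \<nu> = (\<integral>\<^sup>+x. \<integral>\<^sup>+\<omega>. ?w \<omega> * (?I x \<omega> * emeasure \<nu> {fst \<omega><..snd \<omega>}) \<partial>?L \<partial>\<mu>)"
    by (simp add: energy_def pot)
  also have "\<dots> = (\<integral>\<^sup>+\<omega>. \<integral>\<^sup>+x. ?w \<omega> * (?I x \<omega> * emeasure \<nu> {fst \<omega><..snd \<omega>}) \<partial>\<mu> \<partial>?L)"
    by (rule Lm.Fubini'[symmetric]) measurable
  also have "\<dots> = (\<integral>\<^sup>+\<omega>. ?w \<omega> * (emeasure \<mu> {fst \<omega><..snd \<omega>} * emeasure \<nu> {fst \<omega><..snd \<omega>}) \<partial>?L)"
    by (intro nn_integral_cong) (simp add: nn_integral_cmult nn_integral_multc)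
  finally show ?thesis .
qed

end

subsection \<open>Linear combinations of measures\<close>

text \<open>Coefficients pass through \<open>ennreal\<close>, so a negative one counts as 0; the
  real-valued rules therefore ask for nonnegative ones.\<close>

definition comb :: "real \<Rightarrow> real measure \<Rightarrow> real \<Rightarrow> real measure \<Rightarrow> real measure" where
  "comb a \<mu> b \<nu> = measure_of UNIV (sets borel) (\<lambda>A. ennreal a * emeasure \<mu> A + ennreal b * emeasure \<nu> A)"

lemma sets_comb [simp, measurable_cong]: "sets (comb a \<mu> b \<nu>) = sets borel"
  unfolding comb_def by (subst sets_measure_of) (auto simp: sets.sigma_sets_eq[of borel, simplified])

lemma space_comb [simp]: "space (comb a \<mu> b \<nu>) = UNIV"
  unfolding comb_def by (simp add: space_measure_of_conv)

lemma emeasure_comb: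
  assumes "sets \<mu> = sets borel" "sets \<nu> = sets borel" "A \<in> sets borel"
  shows "emeasure (comb a \<mu> b \<nu>) A = ennreal a * emeasure \<mu> A + ennreal b * emeasure \<nu> A"
  unfolding comb_def
proof (rule emeasure_measure_of_sigma)
  show "sigma_algebra UNIV (sets (borel :: real measure))"
    using sets.sigma_algebra_axioms[of "borel :: real measure"] by simp
  show "positive (sets borel) (\<lambda>A. ennreal a * emeasure \<mu> A + ennreal b * emeasure \<nu> A)"
    by (simp add: positive_def)
  show "countably_additive (sets borel) (\<lambda>A. ennreal a * emeasure \<mu> A + ennreal b * emeasure \<nu> A)"
    unfolding countably_additive_def
  proof safe
    fix A :: "nat \<Rightarrow> real set"
    assume A: "range A \<subseteq> sets borel" "disjoint_family A"
    show "(\<Sum>i. ennreal a * emeasure \<mu> (A i) + ennreal b * emeasure \<nu> (A i))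
        = ennreal a * emeasure \<mu> (\<Union> (range A)) + ennreal b * emeasure \<nu> (\<Union> (range A))"
      using A assms by (simp add: suminf_add[symmetric] suminf_emeasure)
  qed
qed (use assms in simp_all)

lemma nn_integral_comb:
  assumes sets: "sets \<mu> = sets borel" "sets \<nu> = sets borel" and f: "f \<in> borel_measurable borel"
  shows "(\<integral>\<^sup>+x. f x \<partial>comb a \<mu> b \<nu>) = ennreal a * (\<integral>\<^sup>+x. f x \<partial>\<mu>) + ennreal b * (\<integral>\<^sup>+x. f x \<partial>\<nu>)"
proof -
  note sets[measurable_cong]
  show ?thesis
    using f
  proof (induction rule: borel_measurable_induct)
    case (cong f g)
    then have "f = g" by auto
    with cong show ?case by simp
  next
    case (set A)
    then show ?case by (simp add: emeasure_comb assms)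
  next
    case (mult u c)
    then show ?case by (simp add: nn_integral_cmult distrib_left mult.left_commute)
  next
    case (add u v)
    then show ?case by (simp add: nn_integral_add distrib_left add_ac)
  next
    case (seq U)
    have SUP: "(\<integral>\<^sup>+x. (SUP i. U i) x \<partial>N) = (SUP i. \<integral>\<^sup>+x. U i x \<partial>N)"
      if [measurable_cong]: "sets N = sets borel" for N :: "real measure"
      using seq(1) \<open>incseq U\<close> unfolding SUP_apply by (intro nn_integral_monotone_convergence_SUP) auto
    have inc: "incseq (\<lambda>i. ennreal c * (\<integral>\<^sup>+x. U i x \<partial>N))" for c and N :: "real measure"
      using \<open>incseq U\<close> by (auto simp: incseq_def le_fun_def intro!: mult_left_mono nn_integral_mono)
    show ?case
      by (simp only: SUP sets sets_comb seq SUP_mult_left_ennreal ennreal_SUP_add[OF inc inc])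
  qed
qed

lemma finite_borel_measure_comb:
  assumes "finite_borel_measure \<mu>" "finite_borel_measure \<nu>"
  shows "finite_borel_measure (comb a \<mu> b \<nu>)"
proof -
  interpret m: finite_borel_measure \<mu> by fact
  interpret n: finite_borel_measure \<nu> by fact
  show ?thesis
    using m.emeasure_finite[of UNIV] n.emeasure_finite[of UNIV]
    by (intro finite_borel_measureI finite_measureI)
      (auto simp: emeasure_comb m.M_is_borel n.M_is_borel ennreal_mult_eq_top_iff)
qed

lemma measure_comb:
  assumes "finite_borel_measure \<mu>" "finite_borel_measure \<nu>" "0 \<le> a" "0 \<le> b" "A \<in> sets borel"
  shows "measure (comb a \<mu> b \<nu>) A = a * measure \<mu> A + b * measure \<nu> A"
proof -
  interpret m: finite_borel_measure \<mu> by fact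
  interpret n: finite_borel_measure \<nu> by fact
  show ?thesis using assms unfolding measure_def
    by (simp add: emeasure_comb m.M_is_borel n.M_is_borel m.emeasure_eq_measure n.emeasure_eq_measure
        ennreal_mult[symmetric] ennreal_plus[symmetric] del: ennreal_plus)
qed

text \<open>An interval to the right of \<open>a\<close> has positive Lebesgue measure, so it must
  meet every property that holds almost everywhere. With right continuity this upgrades
  almost-everywhere statements on distribution functions to all points.\<close>

lemma frequently_at_right_lborel:
  fixes a :: real
  assumes "AE x in lborel. P x"
  shows "\<exists>\<^sub>F x in at_right a. P x"
proof (rule ccontr)
  assume "\<not> ?thesis"
  then have "\<forall>\<^sub>F x in at_right a. \<not> P x" by (simp add: frequently_def)
  then obtain c where c: "a < c" "\<And>x. a < x \<Longrightarrow> x < c \<Longrightarrow> \<not> P x"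
    by (auto simp: eventually_at_right_field)
  have "AE x in lborel. x \<notin> {a<..<c}"
    using assms by eventually_elim (use c in auto)
  then have "emeasure lborel {a<..<c} = 0"
    by (subst (asm) AE_iff_measurable[OF _ refl]) (auto simp: greaterThanLessThan_def greaterThan_def lessThan_def Int_def)
  then show False using c by simp
qed

lemma right_continuous_eqI:
  fixes F :: "real \<Rightarrow> real"
  assumes "continuous (at_right a) F" "\<exists>\<^sub>F x in at_right a. F x = k"
  shows "F a = k"
proof (rule ccontr)
  assume "F a \<noteq> k"
  with assms(1) have "\<forall>\<^sub>F x in at_right a. F x \<noteq> k"
    by (intro tendsto_imp_eventually_ne[of F "F a"]) (auto simp: continuous_within)
  with assms(2) show False by (simp add: frequently_def)
qed

section \<open>Positive definiteness of the energy\<close>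

context riesz
begin

lemma energy_commute:
  "finite_borel_measure \<mu> \<Longrightarrow> finite_borel_measure \<nu> \<Longrightarrow> energy \<mu> \<nu> = energy \<nu> \<mu>"
  by (simp add: energy_eq_nn_integral mult.commute)

lemma energy_comb_left:
  assumes "finite_borel_measure \<mu>" "finite_borel_measure \<nu>" "finite_borel_measure \<rho>"
  shows "energy (comb a \<mu> b \<nu>) \<rho> = ennreal a * energy \<mu> \<rho> + ennreal b * energy \<nu> \<rho>"
  using assms unfolding energy_def
  by (intro nn_integral_comb) (auto simp: finite_borel_measure.M_is_borel measurable_potential)

definition finite_energy :: "real measure \<Rightarrow> bool" where
  "finite_energy \<mu> \<longleftrightarrow> finite_borel_measure \<mu> \<and> energy \<mu> \<mu> < \<infinity>"

text \<open>The squared weighted norm of the difference of the two interval-mass functions. As an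
  integral of a nonnegative function it makes sense for all finite measures, even of infinite
  energy, and is open to Fatou's lemma.\<close>

definition sq_dist :: "real measure \<Rightarrow> real measure \<Rightarrow> ennreal" where
  "sq_dist \<mu> \<nu> = (\<integral>\<^sup>+\<omega>. weight (fst \<omega>) (snd \<omega>) *
     ennreal ((measure \<mu> {fst \<omega><..snd \<omega>} - measure \<nu> {fst \<omega><..snd \<omega>})\<^sup>2) \<partial>(lborel \<Otimes>\<^sub>M lborel))"

lemma measurable_measure_Ioc:
  assumes "finite_borel_measure \<mu>"
  shows "(\<lambda>\<omega>. measure \<mu> {fst \<omega><..snd \<omega>}) \<in> borel_measurable (lborel \<Otimes>\<^sub>M lborel)"
proof -
  interpret finite_borel_measure \<mu> by fact
  have [measurable]: "cdf \<mu> \<in> borel_measurable borel"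
    by (intro borel_measurable_mono) (simp add: mono_def cdf_nondecreasing)
  have "measure \<mu> {fst \<omega><..snd \<omega>} = (if fst \<omega> < snd \<omega> then cdf \<mu> (snd \<omega>) - cdf \<mu> (fst \<omega>) else 0)" for \<omega>
    by (simp add: cdf_diff_eq)
  then show ?thesis by simp
qed

lemma energy_eq_measure:
  assumes "finite_borel_measure \<mu>" "finite_borel_measure \<nu>"
  shows "energy \<mu> \<nu> = (\<integral>\<^sup>+\<omega>. weight (fst \<omega>) (snd \<omega>) *
     ennreal (measure \<mu> {fst \<omega><..snd \<omega>} * measure \<nu> {fst \<omega><..snd \<omega>}) \<partial>(lborel \<Otimes>\<^sub>M lborel))"
proof -
  interpret m: finite_borel_measure \<mu> by fact
  interpret n: finite_borel_measure \<nu> by fact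
  show ?thesis using assms
    by (simp add: energy_eq_nn_integral m.emeasure_eq_measure n.emeasure_eq_measure ennreal_mult)
qed

text \<open>Pointwise this is the binomial formula for \<open>(x - y)\<^sup>2\<close>. The cross
  term stands on the right, so that no possibly infinite value is subtracted.\<close>

lemma sq_dist_expand:
  assumes "finite_borel_measure \<mu>" "finite_borel_measure \<nu>"
  shows "energy \<mu> \<mu> + energy \<nu> \<nu> = sq_dist \<mu> \<nu> + 2 * energy \<mu> \<nu>"
proof -
  note [measurable] = assms[THEN measurable_measure_Ioc]
  have *: "ennreal (x * x) + ennreal (y * y) = ennreal ((x - y)\<^sup>2) + 2 * ennreal (x * y)"
    if "0 \<le> x" "0 \<le> y" for x y :: real
  proof -
    have "ennreal (x * x) + ennreal (y * y) = ennreal ((x - y)\<^sup>2 + 2 * (x * y))"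
      using that by (simp add: ennreal_plus[symmetric] power2_eq_square algebra_simps del: ennreal_plus)
    then show ?thesis
      using that by (simp add: ennreal_mult'[of 2, simplified])
  qed
  show ?thesis
    unfolding energy_eq_measure[OF assms] energy_eq_measure[OF assms(1) assms(1)]
      energy_eq_measure[OF assms(2) assms(2)] sq_dist_def
    by (subst nn_integral_cmult[symmetric], measurable, subst (1 2) nn_integral_add[symmetric], measurable)
      (simp add: * distrib_left[symmetric] mult.left_commute[of 2])
qed

text \<open>Since \<open>sq_dist\<close> is nonnegative, the expansion bounds twice the mutual
  energy by the sum of the two self-energies.\<close>

lemma energy_finite:
  assumes "finite_energy \<mu>" "finite_energy \<nu>"
  shows "energy \<mu> \<nu> < \<infinity>"
proof -
  have "sq_dist \<mu> \<nu> + 2 * energy \<mu> \<nu> < \<infinity>"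
    using assms sq_dist_expand[of \<mu> \<nu>] unfolding finite_energy_def
    by (metis ennreal_add_less_top infinity_ennreal_def)
  then show ?thesis by (auto simp: ennreal_mult_less_top)
qed

lemma finite_energy_comb:
  assumes "finite_energy \<mu>" "finite_energy \<nu>"
  shows "finite_energy (comb a \<mu> b \<nu>)"
proof -
  have fb: "finite_borel_measure \<mu>" "finite_borel_measure \<nu>" "finite_borel_measure (comb a \<mu> b \<nu>)"
    using assms by (auto simp: finite_energy_def finite_borel_measure_comb)
  note lin = energy_comb_left[OF fb(1,2)]
  have "energy \<mu> (comb a \<mu> b \<nu>) < \<infinity>" "energy \<nu> (comb a \<mu> b \<nu>) < \<infinity>"
    using energy_finite assms fb lin[OF fb(1)] lin[OF fb(2)]
    by (simp_all add: energy_commute[OF _ fb(3)] ennreal_mult_less_top)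
  then show ?thesis
    using fb lin[OF fb(3)] by (simp add: finite_energy_def ennreal_mult_less_top)
qed

text \<open>The weight is positive for \<open>u < v\<close>, so almost all intervals have equal mass
  under both measures. Hence the difference \<open>F\<close> of the distribution functions takes the
  same value at almost all pairs of points, and right continuity extends this to all pairs.\<close>

lemma sq_dist_eq_0:
  assumes fb: "finite_borel_measure \<mu>" "finite_borel_measure \<nu>" and zero: "sq_dist \<mu> \<nu> = 0"
  shows "\<mu> = \<nu>"
proof -
  interpret m: finite_borel_measure \<mu> by fact
  interpret n: finite_borel_measure \<nu> by fact
  note [measurable] = fb[THEN measurable_measure_Ioc]
  define F where "F x = cdf \<mu> x - cdf \<nu> x" for x
  have cont: "continuous (at_right a) F" for a
    unfolding F_def by (intro continuous_intros m.cdf_is_right_cont n.cdf_is_right_cont)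
  have "AE \<omega> in lborel \<Otimes>\<^sub>M lborel. weight (fst \<omega>) (snd \<omega>) *
     ennreal ((measure \<mu> {fst \<omega><..snd \<omega>} - measure \<nu> {fst \<omega><..snd \<omega>})\<^sup>2) = 0"
    using zero unfolding sq_dist_def by (subst (asm) nn_integral_0_iff_AE) auto
  then have "AE \<omega> in lborel \<Otimes>\<^sub>M lborel. fst \<omega> < snd \<omega> \<longrightarrow> F (fst \<omega>) = F (snd \<omega>)"
  proof eventually_elim
    case (elim \<omega>)
    show ?case
    proof
      assume less: "fst \<omega> < snd \<omega>"
      have "0 < s * (s + 1) * (snd \<omega> - fst \<omega>) powr (- s - 2)"
        using less s_pos by (intro mult_pos_pos) auto
      then have "measure \<mu> {fst \<omega><..snd \<omega>} = measure \<nu> {fst \<omega><..snd \<omega>}"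
        using elim less by (auto simp: weight_def ennreal_mult[symmetric])
      then show "F (fst \<omega>) = F (snd \<omega>)"
        using m.cdf_diff_eq[OF less] n.cdf_diff_eq[OF less] by (simp add: F_def)
    qed
  qed
  then have AE: "AE u in lborel. AE v in lborel. u < v \<longrightarrow> F u = F v"
    by (auto dest!: lborel_pair.AE_pair)
  \<comment> \<open>First the exceptional set in \<open>v\<close> is removed by approaching
    \<open>v\<close> from the right; the next step removes the one in \<open>u\<close> in the same
    way.\<close>
  have *: "AE u in lborel. \<forall>v>u. F v = F u"
    using AE
  proof eventually_elim
    case (elim u)
    show ?case
    proof safe
      fix v assume "u < v"
      have "\<exists>\<^sub>F x in at_right v. u < x \<longrightarrow> F u = F x"
        by (rule frequently_at_right_lborel[OF elim])
      moreover have "\<forall>\<^sub>F x in at_right v. u < x"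
        using \<open>u < v\<close> by (auto simp: eventually_at_right_field intro!: exI[of _ "v + 1"])
      ultimately have "\<exists>\<^sub>F x in at_right v. (u < x \<longrightarrow> F u = F x) \<and> u < x"
        by (rule frequently_eventually_frequently)
      then have "\<exists>\<^sub>F x in at_right v. F x = F u"
        by (rule frequently_elim1) auto
      then show "F v = F u" by (rule right_continuous_eqI[OF cont])
    qed
  qed
  have const: "F a = F b" if "a < b" for a b
  proof -
    have "\<exists>\<^sub>F x in at_right a. \<forall>v>x. F v = F x"
      by (rule frequently_at_right_lborel[OF *])
    moreover have "\<forall>\<^sub>F x in at_right a. x < b"
      using that by (auto simp: eventually_at_right_field)
    ultimately have "\<exists>\<^sub>F x in at_right a. (\<forall>v>x. F v = F x) \<and> x < b"
      by (rule frequently_eventually_frequently)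
    then have "\<exists>\<^sub>F x in at_right a. F x = F b"
      by (rule frequently_elim1) auto
    then show ?thesis by (rule right_continuous_eqI[OF cont])
  qed
  \<comment> \<open>Both distribution functions vanish at minus infinity, which fixes the constant
    value of \<open>F\<close>.\<close>
  have "(F \<longlongrightarrow> 0 - 0) at_bot"
    unfolding F_def by (intro tendsto_diff m.cdf_lim_at_bot n.cdf_lim_at_bot)
  moreover have "(F \<longlongrightarrow> F b) at_bot" for b
    by (rule tendsto_eventually) (use const in \<open>auto simp: eventually_at_bot_dense intro!: exI[of _ b]\<close>)
  ultimately have "F b = 0" for b
    using tendsto_unique[of at_bot F "F b" 0] by simp
  then have "cdf \<mu> = cdf \<nu>" by (auto simp: F_def)
  then show ?thesis using fb by (intro cdf_unique')
qed

text \<open>\<open>enn2real\<close> sends infinity to 0, so the value represents the mutual energy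
  only where that is finite.\<close>

definition en :: "real measure \<Rightarrow> real measure \<Rightarrow> real" where
  "en \<mu> \<nu> = enn2real (energy \<mu> \<nu>)"

lemma ennreal_en: "finite_energy \<mu> \<Longrightarrow> finite_energy \<nu> \<Longrightarrow> ennreal (en \<mu> \<nu>) = energy \<mu> \<nu>"
  unfolding en_def using energy_finite[of \<mu> \<nu>] by (simp add: less_top)

lemma en_nonneg: "0 \<le> en \<mu> \<nu>"
  by (simp add: en_def)

lemma en_commute: "finite_energy \<mu> \<Longrightarrow> finite_energy \<nu> \<Longrightarrow> en \<mu> \<nu> = en \<nu> \<mu>"
  by (simp add: en_def finite_energy_def energy_commute)

lemma en_comb_left:
  assumes "finite_energy \<mu>" "finite_energy \<nu>" "finite_energy \<rho>" "0 \<le> a" "0 \<le> b"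
  shows "en (comb a \<mu> b \<nu>) \<rho> = a * en \<mu> \<rho> + b * en \<nu> \<rho>"
proof -
  have "ennreal (en (comb a \<mu> b \<nu>) \<rho>) = ennreal (a * en \<mu> \<rho> + b * en \<nu> \<rho>)"
    using assms by (simp add: ennreal_en finite_energy_comb ennreal_mult en_nonneg)
      (simp add: energy_comb_left finite_energy_def)
  then show ?thesis using assms by (subst (asm) ennreal_inj) (auto simp: en_nonneg)
qed

lemma en_comb_right:
  assumes "finite_energy \<mu>" "finite_energy \<nu>" "finite_energy \<rho>" "0 \<le> a" "0 \<le> b"
  shows "en \<rho> (comb a \<mu> b \<nu>) = a * en \<rho> \<mu> + b * en \<rho> \<nu>"
  using assms by (simp add: en_commute[of \<rho>] finite_energy_comb en_comb_left)

lemma sq_dist_eq_en: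
  assumes "finite_energy \<mu>" "finite_energy \<nu>"
  shows "sq_dist \<mu> \<nu> = ennreal (en \<mu> \<mu> + en \<nu> \<nu> - 2 * en \<mu> \<nu>)"
    and "0 \<le> en \<mu> \<mu> + en \<nu> \<nu> - 2 * en \<mu> \<nu>"
proof -
  have eq: "ennreal (en \<mu> \<mu> + en \<nu> \<nu>) = sq_dist \<mu> \<nu> + ennreal (2 * en \<mu> \<nu>)"
    using assms sq_dist_expand[of \<mu> \<nu>]
    by (simp add: ennreal_en ennreal_mult en_nonneg finite_energy_def)
  then have "sq_dist \<mu> \<nu> < \<infinity>" by (metis ennreal_less_top infinity_ennreal_def ennreal_add_eq_top less_top)
  then obtain d where d: "0 \<le> d" "sq_dist \<mu> \<nu> = ennreal d" by (cases "sq_dist \<mu> \<nu>") auto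
  with eq have "ennreal (en \<mu> \<mu> + en \<nu> \<nu>) = ennreal (d + 2 * en \<mu> \<nu>)"
    by (simp add: en_nonneg)
  then have "en \<mu> \<mu> + en \<nu> \<nu> = d + 2 * en \<mu> \<nu>"
    using d by (subst (asm) ennreal_inj) (auto simp: en_nonneg)
  then have "d = en \<mu> \<mu> + en \<nu> \<nu> - 2 * en \<mu> \<nu>" by simp
  then show "sq_dist \<mu> \<nu> = ennreal (en \<mu> \<mu> + en \<nu> \<nu> - 2 * en \<mu> \<nu>)" "0 \<le> en \<mu> \<mu> + en \<nu> \<nu> - 2 * en \<mu> \<nu>"
    using d by auto
qed

text \<open>Definiteness in real form; uniqueness and both identifications of a minimizer with
  \<open>q\<sigma>\<close> rest on it.\<close>

lemma en_sq_dist_le_0: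
  assumes "finite_energy \<mu>" "finite_energy \<nu>" "en \<mu> \<mu> + en \<nu> \<nu> - 2 * en \<mu> \<nu> \<le> 0"
  shows "\<mu> = \<nu>"
  using assms sq_dist_eq_en[of \<mu> \<nu>] by (intro sq_dist_eq_0) (auto simp: finite_energy_def)

end

subsection \<open>Uniform measures and balayage\<close>

text \<open>The inversion used for the balayage is undefined at one point and misses one value; this
  removes and restores such points.\<close>

lemma has_integral_remove_point:
  fixes f :: "real \<Rightarrow> real"
  shows "(f has_integral i) (- {a}) \<longleftrightarrow> (f has_integral i) UNIV"
  by (rule has_integral_spike_set_eq[OF empty_imp_negligible negligible_subset[OF negligible_sing[of a]]]) auto

context riesz
begin

lemma nn_integral_powr_from_0:
  assumes "0 \<le> L"
  shows "(\<integral>\<^sup>+t. ennreal (t powr (- s)) * indicator {0..L} t \<partial>lborel) = ennreal (L powr (1 - s) / (1 - s))"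
proof -
  have "((\<lambda>t. t powr (- s)) has_integral (L powr (- s + 1) / (- s + 1))) {0..L}"
    using assms s_less by (intro has_integral_powr_from_0) auto
  from nn_integral_has_integral_lebesgue'[OF _ this] show ?thesis by (simp add: add.commute)
qed

definition unif :: "real \<Rightarrow> real \<Rightarrow> real measure" where
  "unif a L = uniform_measure lborel {a..a + L}"

lemma prob_space_unif: "0 < L \<Longrightarrow> prob_space (unif a L)"
  unfolding unif_def by (intro prob_space_uniform_measure) auto

lemma sets_unif [simp, measurable_cong]: "sets (unif a L) = sets borel"
  by (simp add: unif_def)

lemma finite_borel_measure_unif: "0 < L \<Longrightarrow> finite_borel_measure (unif a L)"
  using prob_space.finite_measure[OF prob_space_unif] by (simp add: finite_borel_measureI)

lemma nn_integral_unif: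
  assumes "0 < L" "f \<in> borel_measurable borel"
  shows "(\<integral>\<^sup>+x. f x \<partial>unif a L) = (\<integral>\<^sup>+x. f x * indicator {a..a + L} x \<partial>lborel) / ennreal L"
  using assms by (simp add: unif_def nn_integral_uniform_measure)

text \<open>Points within distance \<open>L\<close> of \<open>x\<close> contribute at most the
  integral of \<open>t powr (- s)\<close> over \<open>{0..L}\<close> on each side; farther points
  contribute at most \<open>L powr (- s)\<close> on a set of length at most \<open>L\<close>.
  Dividing by \<open>L\<close> gives a bound of order \<open>L powr (- s)\<close>, uniform in
  \<open>x\<close>.\<close>

lemma potential_unif_le:
  assumes L: "0 < L"
  shows "potential (unif a L) x \<le> ennreal ((2 / (1 - s) + 1) * L powr (- s))"
proof -
  let ?G = "\<lambda>t. ennreal (t powr (- s)) * indicator {0..L} t"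
  let ?R = "\<lambda>y. (?G (y - x) + ?G (x - y)) + ennreal (L powr (- s)) * indicator {a..a + L} y"
  have pot: "potential (unif a L) x = (\<integral>\<^sup>+y. riesz_kernel s x y * indicator {a..a + L} y \<partial>lborel) / ennreal L"
    unfolding potential_def using L by (intro nn_integral_unif) auto
  have "(\<integral>\<^sup>+y. riesz_kernel s x y * indicator {a..a + L} y \<partial>lborel) \<le> (\<integral>\<^sup>+y. ?R y \<partial>lborel)"
  proof (rule nn_integral_mono_AE)
    show "AE y in lborel. riesz_kernel s x y * indicator {a..a + L} y \<le> ?R y"
      using AE_lborel_singleton[of x]
    proof eventually_elim
      case (elim y)
      show ?case
      proof (cases "\<bar>x - y\<bar> \<le> L")
        case True
        then have "riesz_kernel s x y \<le> ?G (y - x) + ?G (x - y)"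
          using elim by (cases "x < y") (auto simp: riesz_kernel_def)
        moreover have "riesz_kernel s x y * indicator {a..a + L} y \<le> riesz_kernel s x y"
          by (simp add: indicator_def)
        ultimately show ?thesis by (meson add_increasing2 order_trans zero_le)
      next
        case False
        then have "riesz_kernel s x y \<le> ennreal (L powr (- s))"
          using elim L s_pos by (auto simp: riesz_kernel_def intro!: ennreal_leI powr_mono2')
        then show ?thesis by (auto simp: indicator_def intro: add_increasing)
      qed
    qed
  qed
  also have "(\<integral>\<^sup>+y. ?R y \<partial>lborel) = (\<integral>\<^sup>+y. ?G (y - x) \<partial>lborel) + (\<integral>\<^sup>+y. ?G (x - y) \<partial>lborel)
      + ennreal (L powr (- s)) * ennreal L"
    using L by (simp add: nn_integral_add nn_integral_cmult_indicator)
  also have "(\<integral>\<^sup>+y. ?G (y - x) \<partial>lborel) = (\<integral>\<^sup>+t. ?G t \<partial>lborel)"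
    by (subst (2) nn_integral_real_affine[of _ 1 "- x"]) auto
  also have "(\<integral>\<^sup>+y. ?G (x - y) \<partial>lborel) = (\<integral>\<^sup>+t. ?G t \<partial>lborel)"
    by (subst (2) nn_integral_real_affine[of _ "-1" x]) auto
  also have "(\<integral>\<^sup>+t. ?G t \<partial>lborel) = ennreal (L powr (1 - s) / (1 - s))"
    using L by (intro nn_integral_powr_from_0) auto
  finally have "(\<integral>\<^sup>+y. riesz_kernel s x y * indicator {a..a + L} y \<partial>lborel) / ennreal L
      \<le> (ennreal (L powr (1 - s) / (1 - s)) + ennreal (L powr (1 - s) / (1 - s))
        + ennreal (L powr (- s)) * ennreal L) / ennreal L"
    by (rule divide_right_mono_ennreal)
  also have "\<dots> = ennreal ((L powr (1 - s) / (1 - s) + L powr (1 - s) / (1 - s) + L powr (- s) * L) / L)"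
    using L s_less by (simp add: ennreal_plus[symmetric] ennreal_mult[symmetric] divide_ennreal del: ennreal_plus)
  also have "(L powr (1 - s) / (1 - s) + L powr (1 - s) / (1 - s) + L powr (- s) * L) / L
      = (2 / (1 - s) + 1) * L powr (- s)"
  proof -
    have e: "L powr (1 - s) = L * L powr (- s)"
      using L powr_add[of L 1 "- s"] by simp
    have H: "(L * p / r + L * p / r + p * L) / L = (2 / r + 1) * p" if "0 < r" for p r
      using L that by (simp add: field_simps)
    show ?thesis unfolding e by (rule H) (use s_less in simp)
  qed
  finally show ?thesis unfolding pot .
qed

lemma energy_unif_le:
  assumes "0 < L" "finite_borel_measure \<nu>"
  shows "energy \<nu> (unif a L) \<le> ennreal ((2 / (1 - s) + 1) * L powr (- s) * measure \<nu> UNIV)"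
proof -
  interpret finite_borel_measure \<nu> by fact
  have "energy \<nu> (unif a L) \<le> (\<integral>\<^sup>+x. ennreal ((2 / (1 - s) + 1) * L powr (- s)) \<partial>\<nu>)"
    unfolding energy_def using assms by (intro nn_integral_mono potential_unif_le)
  also have "\<dots> = ennreal ((2 / (1 - s) + 1) * L powr (- s)) * ennreal (measure \<nu> UNIV)"
    by (simp add: borel_UNIV emeasure_eq_measure)
  also have "\<dots> = ennreal ((2 / (1 - s) + 1) * L powr (- s) * measure \<nu> UNIV)"
    using s_less by (subst ennreal_mult) auto
  finally show ?thesis .
qed

lemma finite_energy_unif: "0 < L \<Longrightarrow> finite_energy (unif a L)"
  using le_less_trans[OF energy_unif_le ennreal_less_top] finite_borel_measure_unif[of L a]
  by (simp add: finite_energy_def)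

lemma en_unif_le:
  assumes "0 < L" "finite_energy \<nu>"
  shows "en \<nu> (unif a L) \<le> (2 / (1 - s) + 1) * L powr (- s) * measure \<nu> UNIV"
  using energy_unif_le[of L \<nu> a] assms s_less unfolding en_def finite_energy_def
  by (intro enn2real_leI) auto

text \<open>The uniform bound on the potential of a long interval decays with its length. Using
  \<open>Suc n\<close> keeps every length positive.\<close>

lemma en_unif_tendsto_0:
  assumes "finite_energy \<nu>"
  shows "(\<lambda>n. en \<nu> (unif 0 (real (Suc n)))) \<longlonglongrightarrow> 0"
proof (rule tendsto_sandwich[where f = "\<lambda>_. 0"])
  show "(\<lambda>n. (2 / (1 - s) + 1) * real (Suc n) powr (- s) * measure \<nu> UNIV) \<longlonglongrightarrow> 0"
    using s_pos by real_asymp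
  show "\<forall>\<^sub>F n in sequentially. en \<nu> (unif 0 (real (Suc n))) \<le> (2 / (1 - s) + 1) * real (Suc n) powr (- s) * measure \<nu> UNIV"
    using assms by (intro always_eventually allI en_unif_le) auto
qed (auto simp: en_nonneg)

lemma en_unif_self_tendsto_0: "(\<lambda>n. en (unif 0 (real (Suc n))) (unif 0 (real (Suc n)))) \<longlonglongrightarrow> 0"
proof (rule tendsto_sandwich[where f = "\<lambda>_. 0"])
  show "(\<lambda>n. (2 / (1 - s) + 1) * real (Suc n) powr (- s)) \<longlonglongrightarrow> 0"
    using s_pos by real_asymp
  have "measure (unif 0 (real (Suc n))) UNIV = 1" for n
    using prob_space.prob_space[OF prob_space_unif[of "real (Suc n)" 0]] by (simp add: unif_def)
  then show "\<forall>\<^sub>F n in sequentially. en (unif 0 (real (Suc n))) (unif 0 (real (Suc n))) \<le> (2 / (1 - s) + 1) * real (Suc n) powr (- s)"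
    using en_unif_le[OF _ finite_energy_unif] by (intro always_eventually allI) (metis mult_1_right of_nat_0_less_iff zero_less_Suc)
qed (auto simp: en_nonneg)

end

section \<open>The distance to \<open>z\<close> and the balayage of the unit mass at
  \<open>z\<close>\<close>

locale riesz_field = riesz +
  fixes z :: complex
  assumes Im_z: "Im z \<noteq> 0"
begin

definition w :: "real \<Rightarrow> real" where
  "w x = cmod (complex_of_real x - z)"

lemma w_pos: "0 < w x"
  using Im_z by (auto simp: w_def complex_eq_iff)

lemma w_nonneg: "0 \<le> w x"
  by (simp add: w_def)

lemma w_square: "(w x)\<^sup>2 = (x - Re z)\<^sup>2 + (Im z)\<^sup>2"
  by (simp add: w_def cmod_power2)

lemma continuous_on_w [continuous_intros]: "continuous_on A f \<Longrightarrow> continuous_on A (\<lambda>x. w (f x))"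
  unfolding w_def by (intro continuous_intros)

lemma measurable_w [measurable]: "w \<in> borel_measurable borel"
  by (intro borel_measurable_continuous_onI continuous_on_w continuous_on_id)

lemma w_ge: "\<bar>x - Re z\<bar> \<le> w x" "\<bar>Im z\<bar> \<le> w x"
  using abs_Re_le_cmod[of "complex_of_real x - z"] abs_Im_le_cmod[of "complex_of_real x - z"]
  by (auto simp: w_def)

text \<open>The argument on the left is the image of \<open>x - u\<close> under inversion in the
  circle about \<open>x\<close> through \<open>z\<close>. This inversion fixes \<open>z\<close>, so
  the distance formula for inversions applies. The point \<open>u - x + 2 * Re z\<close> is the
  mirror image of \<open>x - u\<close> in \<open>Re z\<close>, hence equally far from
  \<open>z\<close>.\<close>

lemma w_inversion:
  assumes "u \<noteq> 0"
  shows "w (x - (w x)\<^sup>2 / u) = w x / \<bar>u\<bar> * w (u - x + 2 * Re z)"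
proof (rule power2_eq_imp_eq)
  have "(x - k / u - Re z)\<^sup>2 + (Im z)\<^sup>2 = k / u\<^sup>2 * ((u - x + 2 * Re z - Re z)\<^sup>2 + (Im z)\<^sup>2)"
    if "k = (x - Re z)\<^sup>2 + (Im z)\<^sup>2" for k
  proof -
    have "(x - k / u - Re z)\<^sup>2 + (Im z)\<^sup>2 = k - 2 * (x - Re z) * k / u + k\<^sup>2 / u\<^sup>2"
      using power2_diff[of "x - Re z" "k / u"] that by (simp add: power_divide diff_diff_eq add.commute)
    also have "\<dots> = k / u\<^sup>2 * (u\<^sup>2 - 2 * (x - Re z) * u + k)"
      using assms by (simp add: field_simps power2_eq_square)
    also have "u\<^sup>2 - 2 * (x - Re z) * u + k = (u - x + 2 * Re z - Re z)\<^sup>2 + (Im z)\<^sup>2"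
      unfolding that by (simp add: power2_eq_square algebra_simps)
    finally show ?thesis .
  qed
  from this[OF w_square[of x]] show "(w (x - (w x)\<^sup>2 / u))\<^sup>2 = (w x / \<bar>u\<bar> * w (u - x + 2 * Re z))\<^sup>2"
    by (simp only: power_mult_distrib power_divide power2_abs w_square[of "x - (w x)\<^sup>2 / u"] w_square[of "u - x + 2 * Re z"])
qed (simp_all add: w_nonneg)

definition total :: real where
  "total = enn2real (\<integral>\<^sup>+y. ennreal (w y powr (s - 2)) \<partial>lborel)"

text \<open>Finiteness: \<open>w\<close> is at least \<open>\<bar>Im z\<bar>\<close> near
  \<open>Re z\<close> and at least \<open>\<bar>y - Re z\<bar>\<close> elsewhere, and both tails
  converge because \<open>s - 2 < - 1\<close>. Positivity: the integrand vanishes nowhere.\<close>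

lemma nn_integral_w: "(\<integral>\<^sup>+y. ennreal (w y powr (s - 2)) \<partial>lborel) = ennreal total"
  and total_pos: "0 < total"
proof -
  define b where "b = \<bar>Im z\<bar>"
  have b: "0 < b" using Im_z by (simp add: b_def)
  let ?I = "\<integral>\<^sup>+y. ennreal (w y powr (s - 2)) \<partial>lborel"
  let ?T = "\<lambda>t. ennreal (t powr (s - 2)) * indicator {b..} t"
  have T: "(\<integral>\<^sup>+t. ?T t \<partial>lborel) = ennreal (1 / (1 - s) * b powr (s - 1))"
    using nn_integral_powr_tail[of b "1 / (1 - s)" "1 - s" "s - 2" 0] b s_less by simp
  have "?I \<le> (\<integral>\<^sup>+y. ennreal (b powr (s - 2)) * indicator {Re z - b..Re z + b} y + ?T (y - Re z) + ?T (Re z - y) \<partial>lborel)"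
  proof (rule nn_integral_mono)
    fix y
    have "ennreal (w y powr (s - 2)) \<le> ennreal (b powr (s - 2))"
      using w_ge[of y] b s_less by (intro ennreal_leI powr_mono2') (auto simp: b_def)
    moreover have "ennreal (w y powr (s - 2)) \<le> ennreal (\<bar>y - Re z\<bar> powr (s - 2))" if "y \<noteq> Re z"
      using w_ge[of y] that s_less by (intro ennreal_leI powr_mono2') auto
    ultimately show "ennreal (w y powr (s - 2)) \<le>
        ennreal (b powr (s - 2)) * indicator {Re z - b..Re z + b} y + ?T (y - Re z) + ?T (Re z - y)"
      using b by (cases "y < Re z - b"; cases "Re z + b < y")
        (auto simp: indicator_def intro: add_increasing add_increasing2)
  qed
  also have "\<dots> = ennreal (b powr (s - 2)) * ennreal (2 * b) + (\<integral>\<^sup>+y. ?T (y - Re z) \<partial>lborel) + (\<integral>\<^sup>+y. ?T (Re z - y) \<partial>lborel)"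
    using b by (simp add: nn_integral_add nn_integral_cmult_indicator)
  also have "(\<integral>\<^sup>+y. ?T (y - Re z) \<partial>lborel) = (\<integral>\<^sup>+t. ?T t \<partial>lborel)"
    by (subst (2) nn_integral_real_affine[of _ 1 "- Re z"]) auto
  also have "(\<integral>\<^sup>+y. ?T (Re z - y) \<partial>lborel) = (\<integral>\<^sup>+t. ?T t \<partial>lborel)"
    by (subst (2) nn_integral_real_affine[of _ "-1" "Re z"]) auto
  also have "ennreal (b powr (s - 2)) * ennreal (2 * b) + (\<integral>\<^sup>+t. ?T t \<partial>lborel) + (\<integral>\<^sup>+t. ?T t \<partial>lborel) < \<infinity>"
    unfolding T by (simp add: ennreal_mult_less_top)
  finally have fin: "?I < \<infinity>" .
  then show eq: "?I = ennreal total" by (simp add: total_def less_top)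
  have "?I \<noteq> 0"
  proof
    assume "?I = 0"
    then have "AE y in lborel. ennreal (w y powr (s - 2)) = 0"
      by (subst (asm) nn_integral_0_iff_AE) auto
    then have "AE y in (lborel :: real measure). False"
      by eventually_elim (metis ennreal_eq_0_iff linorder_not_le powr_gt_zero w_pos less_irrefl)
    from frequently_at_right_lborel[OF this] show False by simp
  qed
  then show "0 < total" using eq by (metis ennreal_0 not_less_iff_gr_or_eq enn2real_nonneg total_def less_eq_real_def)
qed

text \<open>Substitute \<open>y = x - k / u\<close>, the inversion about \<open>x\<close> with
  \<open>k\<close> the square of \<open>w x\<close>. The exponent \<open>s - 2\<close> is the one
  for which the Jacobian cancels all powers of \<open>u\<close>, leaving a multiple of a translate
  of \<open>w y powr (s - 2)\<close>.\<close>

lemma nn_integral_kernel_w: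
  "(\<integral>\<^sup>+y. riesz_kernel s x y * ennreal (w y powr (s - 2)) \<partial>lborel) = ennreal (w x powr (- s) * total)"
proof -
  define k where "k = (w x)\<^sup>2"
  have k: "0 < k" using w_pos[of x] by (simp add: k_def)
  define f where "f y = \<bar>x - y\<bar> powr (- s) * w y powr (s - 2)" for y
  have f_nonneg: "0 \<le> f y" for y by (simp add: f_def)
  define \<phi> where "\<phi> u = w x powr (- s) * w (u - x + 2 * Re z) powr (s - 2)" for u
  define S where "S = - {0 :: real}"
  have [measurable]: "f \<in> borel_measurable borel" "\<phi> \<in> borel_measurable borel"
    unfolding f_def \<phi>_def by measurable
  have "(\<integral>\<^sup>+u. \<phi> u \<partial>lborel) = ennreal (w x powr (- s)) * (\<integral>\<^sup>+u. ennreal (w (u - x + 2 * Re z) powr (s - 2)) \<partial>lborel)"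
    unfolding \<phi>_def by (simp add: ennreal_mult nn_integral_cmult)
  also have "(\<integral>\<^sup>+u. ennreal (w (u - x + 2 * Re z) powr (s - 2)) \<partial>lborel) = ennreal total"
    unfolding nn_integral_w[symmetric]
    by (subst (2) nn_integral_real_affine[of _ 1 "2 * Re z - x"]) (auto simp: algebra_simps)
  finally have "(\<integral>\<^sup>+u. \<phi> u \<partial>lborel) = ennreal (w x powr (- s) * total)"
    by (simp add: ennreal_mult')
  then have "(\<phi> has_integral (w x powr (- s) * total)) UNIV"
    using total_pos by (intro nn_integral_has_integral) (auto simp: \<phi>_def)
  then have "(\<phi> has_integral (w x powr (- s) * total)) S"
    by (simp add: S_def has_integral_remove_point)
  \<comment> \<open>Count powers: the Jacobian, the kernel and the density together leave exponent
    \<open>- s\<close> on \<open>w x\<close> and 0 on \<open>\<bar>u\<bar>\<close>.\<close>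
  moreover have subst: "\<phi> u = \<bar>k / u\<^sup>2\<bar> * f (x - k / u)" if "u \<in> S" for u
  proof -
    have u: "u \<noteq> 0" using that by (simp add: S_def)
    have "\<bar>k / u\<^sup>2\<bar> * f (x - k / u)
        = w x powr 2 / \<bar>u\<bar> powr 2 * ((w x powr 2 / \<bar>u\<bar>) powr (- s) * (w x / \<bar>u\<bar> * w (u - x + 2 * Re z)) powr (s - 2))"
      using u k w_pos[of x] w_inversion[OF u, of x] by (simp add: f_def k_def powr_numeral abs_mult)
    also have "\<dots> = w x powr (2 - 2 * s + (s - 2)) * \<bar>u\<bar> powr (- 2 + s - (s - 2)) * w (u - x + 2 * Re z) powr (s - 2)"
      using u w_pos[of x] w_pos[of "u - x + 2 * Re z"] powr_add[of "w x" s s]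
      by (simp add: powr_divide powr_mult powr_powr powr_add powr_diff powr_minus field_simps del: powr_numeral)
    also have "\<dots> = \<phi> u" using u by (simp add: \<phi>_def)
    finally show ?thesis by simp
  qed
  ultimately have "((\<lambda>u. \<bar>k / u\<^sup>2\<bar> * f (x - k / u)) has_integral (w x powr (- s) * total)) S"
    by (metis (no_types, lifting) has_integral_cong)
  \<comment> \<open>Being nonnegative, the integrand is absolutely integrable, as the change of
    variables requires.\<close>
  then have "(\<lambda>u. \<bar>k / u\<^sup>2\<bar> * f (x - k / u)) absolutely_integrable_on S \<and>
      integral S (\<lambda>u. \<bar>k / u\<^sup>2\<bar> * f (x - k / u)) = w x powr (- s) * total"
    by (auto simp: f_def has_integral_iff intro!: nonnegative_absolutely_integrable_1)
  also have "?this \<longleftrightarrow> f absolutely_integrable_on ((\<lambda>u. x - k / u) ` S) \<and>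
      integral ((\<lambda>u. x - k / u) ` S) f = w x powr (- s) * total"
  proof (rule has_absolute_integral_change_of_variables_1')
    show "((\<lambda>u. x - k / u) has_real_derivative k / u\<^sup>2) (at u within S)" if "u \<in> S" for u
      using that by (auto intro!: derivative_eq_intros simp: S_def power2_eq_square)
    show "inj_on (\<lambda>u. x - k / u) S"
      using k by (auto simp: inj_on_def S_def field_simps)
  qed (auto simp: S_def)
  finally have "(f has_integral (w x powr (- s) * total)) ((\<lambda>u. x - k / u) ` S)"
    by (auto simp: has_integral_iff intro: set_lebesgue_integral_eq_integral)
  moreover have "(\<lambda>u. x - k / u) ` S = - {x}"
  proof (intro equalityI subsetI)
    fix y assume "y \<in> - {x}"
    then have "y = x - k / (k / (x - y))" "k / (x - y) \<in> S" using k by (auto simp: S_def)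
    then show "y \<in> (\<lambda>u. x - k / u) ` S" by blast
  qed (use k in \<open>auto simp: S_def\<close>)
  ultimately have "(f has_integral (w x powr (- s) * total)) (- {x})" by simp
  then have "(f has_integral (w x powr (- s) * total)) UNIV"
    by (simp add: has_integral_remove_point)
  then have "(\<integral>\<^sup>+y. f y \<partial>lborel) = ennreal (w x powr (- s) * total)"
    by (intro nn_integral_has_integral_lborel) (simp_all add: f_nonneg)
  moreover have "(\<integral>\<^sup>+y. riesz_kernel s x y * ennreal (w y powr (s - 2)) \<partial>lborel) = (\<integral>\<^sup>+y. f y \<partial>lborel)"
    using AE_lborel_singleton[of x] by (intro nn_integral_cong_AE)
      (auto simp: riesz_kernel_def f_def ennreal_mult elim!: eventually_mono)
  ultimately show ?thesis by simp
qed

text \<open>This is the balayage of the unit point mass at \<open>z\<close> onto the real line.\<close>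

definition \<sigma> :: "real measure" where
  "\<sigma> = density lborel (\<lambda>y. ennreal (w y powr (s - 2) / total))"

lemma sets_\<sigma> [simp, measurable_cong]: "sets \<sigma> = sets borel"
  by (simp add: \<sigma>_def)

lemma nn_integral_\<sigma>:
  assumes [measurable]: "f \<in> borel_measurable borel"
  shows "(\<integral>\<^sup>+y. f y \<partial>\<sigma>) = (\<integral>\<^sup>+y. f y * ennreal (w y powr (s - 2)) \<partial>lborel) / ennreal total"
proof -
  have "(\<integral>\<^sup>+y. f y \<partial>\<sigma>) = (\<integral>\<^sup>+y. ennreal (w y powr (s - 2) / total) * f y \<partial>lborel)"
    unfolding \<sigma>_def by (rule nn_integral_density) auto
  also have "\<dots> = (\<integral>\<^sup>+y. f y * ennreal (w y powr (s - 2)) / ennreal total \<partial>lborel)"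
    using total_pos by (intro nn_integral_cong) (simp add: divide_ennreal[symmetric] ennreal_times_divide mult.commute)
  also have "\<dots> = (\<integral>\<^sup>+y. f y * ennreal (w y powr (s - 2)) \<partial>lborel) / ennreal total"
    by (rule nn_integral_divide) measurable
  finally show ?thesis .
qed

lemma prob_space_\<sigma>: "prob_space \<sigma>"
proof
  have "emeasure \<sigma> (space \<sigma>) = (\<integral>\<^sup>+y. 1 \<partial>\<sigma>)" by simp
  also have "\<dots> = 1"
    using total_pos by (subst nn_integral_\<sigma>) (auto simp: nn_integral_w divide_ennreal)
  finally show "emeasure \<sigma> (space \<sigma>) = 1" .
qed

lemma finite_borel_measure_\<sigma>: "finite_borel_measure \<sigma>"
  using prob_space.finite_measure[OF prob_space_\<sigma>] by (simp add: finite_borel_measureI)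

lemma measure_\<sigma>: "measure \<sigma> UNIV = 1"
  using prob_space.prob_space[OF prob_space_\<sigma>] by (simp add: \<sigma>_def)

text \<open>The defining property of the balayage: on the line its potential agrees with that of the
  unit mass at \<open>z\<close>, so the field is \<open>- q\<close> times this potential.\<close>

lemma potential_\<sigma>: "potential \<sigma> x = ennreal (w x powr (- s))"
  unfolding potential_def
  using total_pos by (subst nn_integral_\<sigma>) (auto simp: nn_integral_kernel_w divide_ennreal)

lemma w_powr_le: "w x powr (- s) \<le> \<bar>Im z\<bar> powr (- s)"
  using w_ge[of x] s_pos Im_z by (intro powr_mono2') auto

lemma energy_\<sigma>_eq: "energy \<nu> \<sigma> = (\<integral>\<^sup>+x. ennreal (w x powr (- s)) \<partial>\<nu>)"
  by (simp add: energy_def potential_\<sigma>)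

lemma energy_\<sigma>_finite:
  assumes "finite_borel_measure \<nu>"
  shows "energy \<nu> \<sigma> < \<infinity>"
proof -
  interpret finite_borel_measure \<nu> by fact
  have "energy \<nu> \<sigma> \<le> (\<integral>\<^sup>+x. ennreal (\<bar>Im z\<bar> powr (- s)) \<partial>\<nu>)"
    unfolding energy_\<sigma>_eq by (intro nn_integral_mono ennreal_leI w_powr_le)
  also have "\<dots> < \<infinity>"
    by (simp add: emeasure_eq_measure ennreal_mult_less_top)
  finally show ?thesis .
qed

lemma finite_energy_\<sigma>: "finite_energy \<sigma>"
  using energy_\<sigma>_finite[of \<sigma>] finite_borel_measure_\<sigma> by (simp add: finite_energy_def)

end

subsection \<open>The variational problem\<close>

lemma real_prob_measure_iff:
  "real_prob_measure \<nu> \<longleftrightarrow> finite_borel_measure \<nu> \<and> measure \<nu> UNIV = 1"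
proof
  assume "real_prob_measure \<nu>"
  then have "prob_space \<nu>" "sets \<nu> = sets borel" "space \<nu> = UNIV"
    using sets_eq_imp_space_eq[of \<nu> borel] by (auto simp: real_prob_measure_def)
  then show "finite_borel_measure \<nu> \<and> measure \<nu> UNIV = 1"
    using prob_space.finite_measure[of \<nu>] prob_space.prob_space[of \<nu>] by (simp add: finite_borel_measureI)
next
  assume \<nu>: "finite_borel_measure \<nu> \<and> measure \<nu> UNIV = 1"
  then interpret finite_borel_measure \<nu> by simp
  have "prob_space \<nu>"
    using \<nu> by (intro prob_spaceI) (simp add: borel_UNIV emeasure_eq_measure)
  then show "real_prob_measure \<nu>"
    by (simp add: real_prob_measure_def M_is_borel)
qed

locale riesz_field_strength = riesz_field +
  fixes q :: real
  assumes q_pos: "0 < q"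
begin

definition J :: "real measure \<Rightarrow> real" where
  "J \<nu> = en \<nu> \<nu> - 2 * q * en \<nu> \<sigma>"

text \<open>The field integral is \<open>- q\<close> times the mutual energy with \<sigma>, which is
  finite because the potential of \<sigma> is bounded. Hence only the self-energy can make the total
  infinite.\<close>

lemma weighted_energy_eq:
  assumes "finite_borel_measure \<nu>"
  shows "weighted_energy s (field_Q s q z) \<nu> = (if finite_energy \<nu> then ereal (J \<nu>) else \<infinity>)"
proof -
  interpret finite_borel_measure \<nu> by fact
  note M_is_borel[measurable_cong]
  have "(\<integral>x. field_Q s q z x \<partial>\<nu>) = (\<integral>x. - q * w x powr (- s) \<partial>\<nu>)"
    by (intro Bochner_Integration.integral_cong) (auto simp: field_Q_def w_def powr_minus field_simps)
  also have "\<dots> = - q * (\<integral>x. w x powr (- s) \<partial>\<nu>)" by simp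
  also have "(\<integral>x. w x powr (- s) \<partial>\<nu>) = en \<nu> \<sigma>"
    unfolding en_def energy_\<sigma>_eq by (rule integral_eq_nn_integral) auto
  finally have Q: "(\<integral>x. field_Q s q z x \<partial>\<nu>) = - q * en \<nu> \<sigma>" .
  show ?thesis
  proof (cases "finite_energy \<nu>")
    case True
    then show ?thesis
      by (simp add: weighted_energy_def riesz_energy_eq ennreal_en[symmetric] Q J_def enn2ereal_ennreal en_nonneg)
  next
    case False
    then have "energy \<nu> \<nu> = \<infinity>" using assms by (simp add: finite_energy_def less_top[symmetric])
    then show ?thesis using False by (simp add: weighted_energy_def riesz_energy_eq)
  qed
qed

definition equilibrium :: "real measure \<Rightarrow> bool" where
  "equilibrium \<mu> \<longleftrightarrow> finite_energy \<mu> \<and> measure \<mu> UNIV = 1 \<and>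
     (\<forall>\<nu>. finite_energy \<nu> \<longrightarrow> measure \<nu> UNIV = 1 \<longrightarrow> J \<mu> \<le> J \<nu>)"

text \<open>Comparison with \<sigma>, which has finite energy, excludes minimizers of infinite
  energy; competitors of infinite energy have infinite weighted energy and never win.\<close>

lemma is_equilibrium_measure_iff: "is_equilibrium_measure s (field_Q s q z) \<mu> \<longleftrightarrow> equilibrium \<mu>"
proof
  assume eq: "is_equilibrium_measure s (field_Q s q z) \<mu>"
  then have \<mu>: "finite_borel_measure \<mu>" "measure \<mu> UNIV = 1"
    by (auto simp: is_equilibrium_measure_def real_prob_measure_iff)
  have le: "weighted_energy s (field_Q s q z) \<mu> \<le> ereal (J \<nu>)" if "finite_energy \<nu>" "measure \<nu> UNIV = 1" for \<nu>
    using eq that weighted_energy_eq[of \<nu>]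
    by (auto simp: is_equilibrium_measure_def real_prob_measure_iff finite_energy_def)
  have "finite_energy \<mu>"
    using le[OF finite_energy_\<sigma> measure_\<sigma>] \<mu> by (simp add: weighted_energy_eq split: if_splits)
  then show "equilibrium \<mu>" using le \<mu> by (simp add: equilibrium_def weighted_energy_eq)
next
  assume "equilibrium \<mu>"
  then show "is_equilibrium_measure s (field_Q s q z) \<mu>"
    by (auto simp: is_equilibrium_measure_def equilibrium_def real_prob_measure_iff weighted_energy_eq
        finite_energy_def)
qed

lemma equilibrium_finite_energy: "equilibrium \<mu> \<Longrightarrow> finite_energy \<mu>"
  by (simp add: equilibrium_def)

lemma equilibrium_finite_borel: "equilibrium \<mu> \<Longrightarrow> finite_borel_measure \<mu>"
  by (simp add: equilibrium_def finite_energy_def)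

lemma equilibrium_mass: "equilibrium \<mu> \<Longrightarrow> measure \<mu> UNIV = 1"
  by (simp add: equilibrium_def)

lemma equilibriumD: "equilibrium \<mu> \<Longrightarrow> finite_energy \<nu> \<Longrightarrow> measure \<nu> UNIV = 1 \<Longrightarrow> J \<mu> \<le> J \<nu>"
  by (simp add: equilibrium_def)

lemma measure_UNIV_comb:
  "finite_energy \<mu> \<Longrightarrow> finite_energy \<nu> \<Longrightarrow> 0 \<le> a \<Longrightarrow> 0 \<le> b \<Longrightarrow>
    measure (comb a \<mu> b \<nu>) UNIV = a * measure \<mu> UNIV + b * measure \<nu> UNIV"
  by (simp add: measure_comb finite_energy_def)

lemma J_comb:
  assumes "finite_energy \<mu>" "finite_energy \<nu>" "0 \<le> a" "0 \<le> b"
  shows "J (comb a \<mu> b \<nu>) = a\<^sup>2 * en \<mu> \<mu> + 2 * a * b * en \<mu> \<nu> + b\<^sup>2 * en \<nu> \<nu>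
    - 2 * q * (a * en \<mu> \<sigma> + b * en \<nu> \<sigma>)"
proof -
  have "en (comb a \<mu> b \<nu>) (comb a \<mu> b \<nu>)
      = a * (a * en \<mu> \<mu> + b * en \<mu> \<nu>) + b * (a * en \<mu> \<nu> + b * en \<nu> \<nu>)"
    using assms en_commute[of \<nu> \<mu>] by (simp add: en_comb_left en_comb_right finite_energy_comb)
  then show ?thesis
    using assms by (simp add: J_def en_comb_left finite_energy_\<sigma> power2_eq_square algebra_simps)
qed

text \<open>The multiple of \<sigma> by \<open>q\<close>, expressed as a combination with second
  coefficient 0; it minimizes \<open>J\<close> when the mass is left free.\<close>

definition q\<sigma> :: "real measure" where
  "q\<sigma> = comb q \<sigma> 0 \<sigma>"

lemma finite_energy_q\<sigma>: "finite_energy q\<sigma>"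
  by (simp add: q\<sigma>_def finite_energy_comb finite_energy_\<sigma>)

lemma measure_q\<sigma>: "measure q\<sigma> UNIV = q"
  using q_pos by (simp add: q\<sigma>_def measure_comb finite_borel_measure_\<sigma> measure_\<sigma>)

lemma en_q\<sigma>: "finite_energy \<nu> \<Longrightarrow> en \<nu> q\<sigma> = q * en \<nu> \<sigma>"
  using q_pos by (simp add: q\<sigma>_def en_comb_right finite_energy_\<sigma>)

lemma en_q\<sigma>_q\<sigma>: "en q\<sigma> q\<sigma> = q\<^sup>2 * en \<sigma> \<sigma>"
  using q_pos en_q\<sigma>[OF finite_energy_q\<sigma>] en_q\<sigma>[OF finite_energy_\<sigma>]
  by (simp add: en_commute[of q\<sigma> \<sigma>] finite_energy_\<sigma> finite_energy_q\<sigma> power2_eq_square)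

text \<open>Completing the square: \<open>J\<close> is the squared distance to
  \<open>q\<sigma>\<close> up to the constant self-energy of \<open>q\<sigma>\<close>.\<close>

lemma J_eq_sq_dist:
  assumes "finite_energy \<nu>"
  shows "sq_dist \<nu> q\<sigma> = ennreal (J \<nu> + q\<^sup>2 * en \<sigma> \<sigma>)" "0 \<le> J \<nu> + q\<^sup>2 * en \<sigma> \<sigma>"
  using sq_dist_eq_en[OF assms finite_energy_q\<sigma>] assms
  by (auto simp: en_q\<sigma> en_q\<sigma>_q\<sigma> J_def algebra_simps)

lemma J_minimal_imp_eq:
  assumes "finite_energy \<nu>" "J \<nu> + q\<^sup>2 * en \<sigma> \<sigma> \<le> 0"
  shows "\<nu> = q\<sigma>"
  using assms finite_energy_q\<sigma> by (intro en_sq_dist_le_0) (auto simp: en_q\<sigma> en_q\<sigma>_q\<sigma> J_def algebra_simps)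

lemma J_q\<sigma>: "J q\<sigma> = - q\<^sup>2 * en \<sigma> \<sigma>"
  using en_q\<sigma>[OF finite_energy_q\<sigma>] en_q\<sigma>_q\<sigma> by (simp add: J_def)

text \<open>The missing mass can be spread out over long intervals at no cost in energy.\<close>

lemma J_lower_bound_subprob:
  assumes j: "\<And>\<nu>. finite_energy \<nu> \<Longrightarrow> measure \<nu> UNIV = 1 \<Longrightarrow> j \<le> J \<nu>"
    and \<nu>: "finite_energy \<nu>" "measure \<nu> UNIV \<le> 1"
  shows "j \<le> J \<nu>"
proof -
  define c where "c = 1 - measure \<nu> UNIV"
  define \<tau> where "\<tau> n = unif 0 (real (Suc n))" for n
  have c: "0 \<le> c" using \<nu> by (simp add: c_def)
  have \<tau>: "finite_energy (\<tau> n)" for n by (simp add: \<tau>_def finite_energy_unif)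
  have m\<tau>: "measure (\<tau> n) UNIV = 1" for n
    using prob_space.prob_space[OF prob_space_unif[of "real (Suc n)" 0]] by (simp add: \<tau>_def unif_def)
  have "J (comb 1 \<nu> c (\<tau> n)) = en \<nu> \<nu> + 2 * c * en \<nu> (\<tau> n) + c\<^sup>2 * en (\<tau> n) (\<tau> n)
      - 2 * q * (en \<nu> \<sigma> + c * en \<sigma> (\<tau> n))" for n
    using \<nu> \<tau> c by (simp add: J_comb en_commute[OF _ finite_energy_\<sigma>, of "\<tau> n"])
  moreover have "(\<lambda>n. en \<nu> \<nu> + 2 * c * en \<nu> (\<tau> n) + c\<^sup>2 * en (\<tau> n) (\<tau> n)
      - 2 * q * (en \<nu> \<sigma> + c * en \<sigma> (\<tau> n)))
    \<longlonglongrightarrow> en \<nu> \<nu> + 2 * c * 0 + c\<^sup>2 * 0 - 2 * q * (en \<nu> \<sigma> + c * 0)"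
    unfolding \<tau>_def
    by (intro tendsto_intros en_unif_tendsto_0 en_unif_self_tendsto_0 \<nu> finite_energy_\<sigma>)
  ultimately have lim: "(\<lambda>n. J (comb 1 \<nu> c (\<tau> n))) \<longlonglongrightarrow> J \<nu>"
    by (simp add: J_def)
  have "j \<le> J (comb 1 \<nu> c (\<tau> n))" for n
    using \<nu> \<tau> c m\<tau> by (intro j finite_energy_comb) (auto simp: measure_UNIV_comb c_def)
  then show ?thesis using lim by (intro LIMSEQ_le_const) auto
qed

text \<open>By the parallelogram law the average of two minimizers would have \<open>J\<close>
  smaller by a quarter of their squared distance.\<close>

lemma equilibrium_unique:
  assumes "equilibrium \<mu>" "equilibrium \<nu>"
  shows "\<mu> = \<nu>"
proof -
  have fe: "finite_energy \<mu>" "finite_energy \<nu>" and mass: "measure \<mu> UNIV = 1" "measure \<nu> UNIV = 1"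
    using assms by (auto simp: equilibrium_def)
  have "J \<mu> = J \<nu>" using assms by (intro antisym) (auto simp: equilibrium_def)
  moreover have "J \<mu> \<le> J (comb (1/2) \<mu> (1/2) \<nu>)"
    using fe mass by (intro equilibriumD[OF assms(1)]) (auto simp: finite_energy_comb measure_UNIV_comb)
  moreover have "J (comb (1/2) \<mu> (1/2) \<nu>)
      = (J \<mu> + J \<nu>) / 2 - (en \<mu> \<mu> + en \<nu> \<nu> - 2 * en \<mu> \<nu>) / 4"
    using fe by (subst J_comb) (simp_all add: J_def field_simps power2_eq_square)
  ultimately show ?thesis using fe by (intro en_sq_dist_le_0) auto
qed

text \<open>For \<open>q < 1\<close> the free minimizer \<open>q\<sigma>\<close> is a subprobability
  measure, so it bounds the value of any equilibrium from above. The equilibrium would then be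
  \<open>q\<sigma>\<close> itself, whose mass is not 1.\<close>

lemma no_equilibrium:
  assumes "q < 1"
  shows "\<not> equilibrium \<mu>"
proof
  assume eq: "equilibrium \<mu>"
  then have "J \<mu> \<le> J q\<sigma>"
    using assms by (intro J_lower_bound_subprob[OF equilibriumD[OF eq]]) (simp_all add: finite_energy_q\<sigma> measure_q\<sigma>)
  then have "\<mu> = q\<sigma>"
    using eq by (intro J_minimal_imp_eq) (simp_all add: equilibrium_def J_q\<sigma>)
  then show False using eq assms measure_q\<sigma> by (auto simp: equilibrium_def)
qed

section \<open>Lower semicontinuity and existence of the equilibrium\<close>

lemma finite_energyI_sq_dist:
  assumes \<mu>: "finite_borel_measure \<mu>" and fin: "sq_dist \<mu> q\<sigma> < \<infinity>"
  shows "finite_energy \<mu>"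
proof -
  have fb: "finite_borel_measure q\<sigma>" using finite_energy_q\<sigma> by (simp add: finite_energy_def)
  have "energy \<mu> q\<sigma> = ennreal q * energy \<mu> \<sigma>"
    unfolding energy_commute[OF \<mu> fb] unfolding q\<sigma>_def
    using \<mu> by (simp add: energy_comb_left energy_commute finite_borel_measure_\<sigma>)
  \<comment> \<open>The mutual energy with \<open>q\<sigma>\<close> is always finite because the
    potential of \<sigma> is bounded, so a finite distance leaves a finite self-energy.\<close>
  then have "energy \<mu> \<mu> + energy q\<sigma> q\<sigma> < \<infinity>"
    using sq_dist_expand[OF \<mu> fb] fin energy_\<sigma>_finite[OF \<mu>] by (simp add: ennreal_mult_less_top)
  then show ?thesis using \<mu> by (simp add: finite_energy_def)
qed

text \<open>Interval masses converge whenever both end points are continuity points of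
  \<open>F\<close>, hence almost everywhere in the plane, and Fatou's lemma applies. Only increments
  of \<open>F\<close> enter: mass may escape to minus infinity, so \<open>F\<close> may exceed the
  distribution function of the limit by a constant.\<close>

lemma sq_dist_le_limit:
  assumes \<nu>: "\<And>n. finite_borel_measure (\<nu> n)" and \<mu>: "finite_borel_measure \<mu>" and \<tau>: "finite_borel_measure \<tau>"
    and lim: "\<And>x. isCont F x \<Longrightarrow> (\<lambda>n. cdf (\<nu> n) x) \<longlonglongrightarrow> F x" and mono: "mono F"
    and F: "\<And>a b. a < b \<Longrightarrow> measure \<mu> {a<..b} = F b - F a"
  shows "sq_dist \<mu> \<tau> \<le> liminf (\<lambda>n. sq_dist (\<nu> n) \<tau>)"
proof -
  note [measurable] = \<nu>[THEN measurable_measure_Ioc] \<mu>[THEN measurable_measure_Ioc] \<tau>[THEN measurable_measure_Ioc]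
  define D where "D = {x. \<not> isCont F x}"
  have D: "countable D" unfolding D_def by (rule mono_ctble_discont[OF mono])
  have [measurable]: "D \<in> sets borel" by (intro sets.countable[OF _ D]) simp
  have "D \<in> null_sets lborel" using D by (rule countable_imp_null_set_lborel)
  then have AE_D: "AE x in lborel. x \<notin> D" by (rule AE_not_in)
  have "AE \<omega> in lborel \<Otimes>\<^sub>M lborel. fst \<omega> \<notin> D \<and> snd \<omega> \<notin> D"
  proof (rule lborel_pair.AE_pair_measure)
    show "AE x in lborel. AE y in lborel. fst (x, y) \<notin> D \<and> snd (x, y) \<notin> D"
      using AE_D by eventually_elim (use AE_D in simp)
  qed measurable
  then have AE: "AE \<omega> in lborel \<Otimes>\<^sub>M lborel.
      weight (fst \<omega>) (snd \<omega>) * ennreal ((measure \<mu> {fst \<omega><..snd \<omega>} - measure \<tau> {fst \<omega><..snd \<omega>})\<^sup>2)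
      = liminf (\<lambda>n. weight (fst \<omega>) (snd \<omega>) * ennreal ((measure (\<nu> n) {fst \<omega><..snd \<omega>} - measure \<tau> {fst \<omega><..snd \<omega>})\<^sup>2))"
  proof eventually_elim
    case (elim \<omega>)
    have "(\<lambda>n. weight (fst \<omega>) (snd \<omega>) * ennreal ((measure (\<nu> n) {fst \<omega><..snd \<omega>} - measure \<tau> {fst \<omega><..snd \<omega>})\<^sup>2))
      \<longlonglongrightarrow> weight (fst \<omega>) (snd \<omega>) * ennreal ((measure \<mu> {fst \<omega><..snd \<omega>} - measure \<tau> {fst \<omega><..snd \<omega>})\<^sup>2)"
    proof (cases "fst \<omega> < snd \<omega>")
      case True
      have "(\<lambda>n. measure (\<nu> n) {fst \<omega><..snd \<omega>}) \<longlonglongrightarrow> measure \<mu> {fst \<omega><..snd \<omega>}"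
        using elim lim by (simp add: F[OF True] finite_borel_measure.cdf_diff_eq[OF \<nu> True, symmetric] D_def tendsto_diff)
      moreover have "weight (fst \<omega>) (snd \<omega>) \<noteq> \<infinity>" using True by (simp add: weight_def)
      ultimately show ?thesis
        by (intro ennreal_tendsto_cmult tendsto_ennrealI tendsto_intros) (auto simp: less_top[symmetric])
    qed simp
    then show ?case by (simp add: lim_imp_Liminf)
  qed
  have "sq_dist \<mu> \<tau> = (\<integral>\<^sup>+\<omega>. liminf (\<lambda>n. weight (fst \<omega>) (snd \<omega>) *
      ennreal ((measure (\<nu> n) {fst \<omega><..snd \<omega>} - measure \<tau> {fst \<omega><..snd \<omega>})\<^sup>2)) \<partial>(lborel \<Otimes>\<^sub>M lborel))"
    unfolding sq_dist_def by (rule nn_integral_cong_AE[OF AE])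
  also have "\<dots> \<le> liminf (\<lambda>n. sq_dist (\<nu> n) \<tau>)"
    unfolding sq_dist_def by (rule nn_integral_liminf) measurable
  finally show ?thesis .
qed

text \<open>Helly's theorem gives a vague limit along a subsequence. Semicontinuity of the distance
  to \<open>q\<sigma>\<close> bounds its value by \<open>j\<close>, but mass may have been
  lost.\<close>

lemma subprob_minimizer_exists:
  assumes bound: "\<And>\<nu>. finite_energy \<nu> \<Longrightarrow> measure \<nu> UNIV = 1 \<Longrightarrow> j \<le> J \<nu>"
    and \<nu>: "\<And>n. finite_energy (\<nu> n)" "\<And>n. measure (\<nu> n) UNIV = 1" and lim: "(\<lambda>n. J (\<nu> n)) \<longlonglongrightarrow> j"
  obtains \<mu> where "finite_energy \<mu>" "measure \<mu> UNIV \<le> 1" "J \<mu> \<le> j"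
proof -
  have fb: "finite_borel_measure (\<nu> n)" for n using \<nu> by (simp add: finite_energy_def)
  have nn: "0 \<le> cdf (\<nu> n) x" and le1: "cdf (\<nu> n) x \<le> 1" for n x
    using finite_borel_measure.cdf_nonneg[OF fb] finite_borel_measure.cdf_bounded[OF fb, of n x] \<nu>(2)[of n]
    by (auto simp: finite_borel_measure.borel_UNIV[OF fb])
  have "\<bar>cdf (\<nu> n) x\<bar> \<le> 1" for n x using nn le1 by simp
  moreover have "mono (cdf (\<nu> n))" for n
    using finite_borel_measure.cdf_nondecreasing[OF fb] by (simp add: mono_def)
  ultimately have "\<exists>r. strict_mono (r :: nat \<Rightarrow> nat) \<and> (\<exists>F. (\<forall>x. continuous (at_right x) F) \<and> mono F \<and>
      (\<forall>x. \<bar>F x\<bar> \<le> 1) \<and> (\<forall>x. isCont F x \<longrightarrow> (\<lambda>n. cdf (\<nu> (r n)) x) \<longlonglongrightarrow> F x))"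
    using finite_borel_measure.cdf_is_right_cont[OF fb] by (intro Helly_selection) auto
  then   obtain r F where r: "strict_mono (r :: nat \<Rightarrow> nat)" and F: "\<And>x. continuous (at_right x) F" "mono F" "\<And>x. \<bar>F x\<bar> \<le> 1"
    and limF: "\<And>x. isCont F x \<Longrightarrow> (\<lambda>n. cdf (\<nu> (r n)) x) \<longlonglongrightarrow> F x"
    by auto
  \<comment> \<open>Helly's theorem only yields \<open>\<bar>F x\<bar> \<le> 1\<close>. The lower
    bound 0 passes to continuity points, which exist to the left of every \<open>x\<close>, and then
    to \<open>x\<close> by monotonicity.\<close>
  have F_nonneg: "0 \<le> F x" for x
  proof -
    obtain y where "y < x" "isCont F y"
      using open_minus_countable[OF mono_ctble_discont[OF F(2)], of "{..< x}"] by auto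
    then have "0 \<le> F y" using nn by (intro LIMSEQ_le_const[OF limF]) auto
    also have "F y \<le> F x" using \<open>y < x\<close> F(2) by (simp add: mono_def)
    finally show ?thesis .
  qed
  have F_le: "F b - F a \<le> 1" for a b using F(3)[of b] F_nonneg[of a] by simp
  define \<mu> where "\<mu> = interval_measure F"
  have Ioc: "emeasure \<mu> {a<..b} = ennreal (F b - F a)" if "a \<le> b" for a b
    unfolding \<mu>_def using that F by (intro emeasure_interval_measure_Ioc) (auto simp: mono_def)
  have "emeasure \<mu> UNIV = (SUP n. emeasure \<mu> {- real n<..real n})"
  proof -
    have "(\<Union>n. {- real n<..real n}) = UNIV"
      by (auto simp: set_eq_iff) (metis reals_Archimedean2 abs_less_iff less_imp_le minus_less_iff)
    then show ?thesis by (subst SUP_emeasure_incseq) (auto simp: incseq_def \<mu>_def)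
  qed
  also have "\<dots> \<le> 1"
    by (intro SUP_least) (simp add: Ioc F_le)
  finally have mass: "emeasure \<mu> UNIV \<le> 1" .
  have \<mu>: "finite_borel_measure \<mu>"
    using mass by (intro finite_borel_measureI finite_measureI) (auto simp: \<mu>_def top_unique)
  interpret finite_borel_measure \<mu> by fact
  have "measure \<mu> {a<..b} = F b - F a" if "a < b" for a b
    using Ioc[of a b] that F(2) by (simp add: measure_def mono_def)
  then have "sq_dist \<mu> q\<sigma> \<le> liminf (\<lambda>n. sq_dist (\<nu> (r n)) q\<sigma>)"
    using finite_energy_q\<sigma> by (intro sq_dist_le_limit[where F = F]) (auto simp: fb \<mu> limF F finite_energy_def)
  also have "\<dots> = ennreal (j + q\<^sup>2 * en \<sigma> \<sigma>)"
  proof -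
    have "(\<lambda>n. J (\<nu> (r n))) \<longlonglongrightarrow> j" using LIMSEQ_subseq_LIMSEQ[OF lim r] by (simp add: o_def)
    then have "(\<lambda>n. sq_dist (\<nu> (r n)) q\<sigma>) \<longlonglongrightarrow> ennreal (j + q\<^sup>2 * en \<sigma> \<sigma>)"
      using \<nu> by (simp add: J_eq_sq_dist) (intro tendsto_intros tendsto_ennrealI)
    then show ?thesis by (simp add: lim_imp_Liminf)
  qed
  finally have le: "sq_dist \<mu> q\<sigma> \<le> ennreal (j + q\<^sup>2 * en \<sigma> \<sigma>)" .
  show ?thesis
  proof
    show fe: "finite_energy \<mu>"
      using le \<mu> by (intro finite_energyI_sq_dist) (auto intro: le_less_trans)
    show "measure \<mu> UNIV \<le> 1" using mass by (simp add: emeasure_eq_measure)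
    have "0 \<le> j + q\<^sup>2 * en \<sigma> \<sigma>"
      by (rule LIMSEQ_le_const[OF tendsto_add[OF lim tendsto_const]]) (use J_eq_sq_dist \<nu> in auto)
    then show "J \<mu> \<le> j" using le by (simp add: J_eq_sq_dist fe)
  qed
qed

lemma equilibrium_exists:
  assumes q: "1 < q"
  shows "\<exists>\<mu>. equilibrium \<mu>"
proof -
  define V where "V = {J \<nu> |\<nu>. finite_energy \<nu> \<and> measure \<nu> UNIV = 1}"
  have bdd: "bdd_below V"
    unfolding V_def by (rule bdd_belowI[of _ "- q\<^sup>2 * en \<sigma> \<sigma>"]) (use J_eq_sq_dist in fastforce)
  have ne: "V \<noteq> {}" using finite_energy_\<sigma> measure_\<sigma> by (auto simp: V_def)
  define j where "j = Inf V"
  have j: "j \<le> J \<nu>" if "finite_energy \<nu>" "measure \<nu> UNIV = 1" for \<nu>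
    unfolding j_def using that bdd by (intro cInf_lower) (auto simp: V_def)
  have "\<exists>\<nu>. finite_energy \<nu> \<and> measure \<nu> UNIV = 1 \<and> J \<nu> < j + 1 / real (Suc n)" for n
  proof -
    have "Inf V < j + 1 / real (Suc n)" by (simp add: j_def)
    then show ?thesis using cInf_lessD[OF ne] by (fastforce simp: V_def)
  qed
  then obtain \<nu> where \<nu>: "\<And>n. finite_energy (\<nu> n)" "\<And>n. measure (\<nu> n) UNIV = 1"
    "\<And>n. J (\<nu> n) < j + 1 / real (Suc n)" by metis
  have "(\<lambda>n. J (\<nu> n)) \<longlonglongrightarrow> j"
  proof (rule tendsto_sandwich)
    show "(\<lambda>n. j) \<longlonglongrightarrow> j" by simp
    show "(\<lambda>n. j + 1 / real (Suc n)) \<longlonglongrightarrow> j" by real_asymp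
    show "\<forall>\<^sub>F n in sequentially. j \<le> J (\<nu> n)" using j \<nu> by simp
    show "\<forall>\<^sub>F n in sequentially. J (\<nu> n) \<le> j + 1 / real (Suc n)"
      by (intro always_eventually allI less_imp_le \<nu>)
  qed
  with j \<nu>(1,2) obtain \<mu> where \<mu>: "finite_energy \<mu>" "measure \<mu> UNIV \<le> 1" "J \<mu> \<le> j"
    by (rule subprob_minimizer_exists)
  have "measure \<mu> UNIV = 1"
  proof (rule ccontr)
    define m where "m = measure \<mu> UNIV"
    assume "measure \<mu> UNIV \<noteq> 1"
    then have m: "0 \<le> m" "m < 1" using \<mu>(2) by (auto simp: m_def)
    \<comment> \<open>\<open>t\<close> is the weight for which moving from \<mu> towards
      \<open>q\<sigma>\<close> restores mass 1; it lies strictly between 0 and 1 because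
      \<open>m < 1 < q\<close>.\<close>
    define t where "t = (1 - m) / (q - m)"
    have "t * (q - m) = 1 - m" using m q by (simp add: t_def)
    moreover have "(1 - t) * m + t * q = m + t * (q - m)" by (simp add: algebra_simps)
    ultimately have t: "(1 - t) * m + t * q = 1" by simp
    have t01: "0 < t" "t < 1" using m q by (auto simp: t_def field_simps)
    note t = t t01
    \<comment> \<open>\<open>X\<close> is the squared distance from \<mu> to
      \<open>q\<sigma>\<close>. The move scales it by the square of \<open>1 - t\<close>, so
      minimality forces \<open>X = 0\<close>.\<close>
    define X where "X = J \<mu> + q\<^sup>2 * en \<sigma> \<sigma>"
    have "j \<le> J (comb (1 - t) \<mu> t q\<sigma>)"
      using t \<mu>(1) finite_energy_q\<sigma>
      by (intro j) (auto simp: finite_energy_comb measure_UNIV_comb measure_q\<sigma> m_def)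
    also have "J (comb (1 - t) \<mu> t q\<sigma>) = (1 - t)\<^sup>2 * X - q\<^sup>2 * en \<sigma> \<sigma>"
      using t \<mu>(1) finite_energy_q\<sigma> en_q\<sigma>[OF finite_energy_\<sigma>]
      by (subst J_comb) (simp_all add: en_q\<sigma>_q\<sigma> en_q\<sigma> X_def J_def en_commute[of q\<sigma> \<sigma>] finite_energy_\<sigma>
        power2_eq_square algebra_simps)
    finally have "X \<le> (1 - t)\<^sup>2 * X" using \<mu>(3) by (simp add: X_def)
    moreover have "0 \<le> X" using J_eq_sq_dist(2)[OF \<mu>(1)] by (simp add: X_def)
    moreover have "(1 - t)\<^sup>2 < 1" using t by (simp add: power_less_one_iff abs_square_less_1)
    moreover have "(1 - t)\<^sup>2 * X < 1 * X" if "0 < X"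
      using that \<open>(1 - t)\<^sup>2 < 1\<close> by (rule mult_strict_right_mono[rotated])
    ultimately have "X = 0" by linarith
    then have "\<mu> = q\<sigma>" using \<mu>(1) by (intro J_minimal_imp_eq) (auto simp: X_def)
    then show False using measure_q\<sigma> q \<mu>(2) by simp
  qed
  then show ?thesis using \<mu> j by (auto simp: equilibrium_def intro: order_trans)
qed

section \<open>The first variation and the Frostman constant\<close>

definition frostman :: "real measure \<Rightarrow> real" where
  "frostman \<mu> = en \<mu> \<mu> - q * en \<mu> \<sigma>"

text \<open>The lower Frostman condition integrated against \<nu>. With \<open>k\<close> the mass of
  \<nu>, the measure with weights \<open>1 - t * k\<close> on \<mu> and \<open>t\<close> on \<nu>
  has mass 1, and \<open>2 * X\<close> is the derivative of its \<open>J\<close> at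
  \<open>t = 0\<close>.\<close>

lemma variational_inequality:
  assumes \<mu>: "equilibrium \<mu>" and \<nu>: "finite_energy \<nu>"
  shows "frostman \<mu> * measure \<nu> UNIV \<le> en \<mu> \<nu> - q * en \<nu> \<sigma>"
proof -
  define k where "k = measure \<nu> UNIV"
  define Y where "Y = (k\<^sup>2 * en \<mu> \<mu> - 2 * k * en \<mu> \<nu> + en \<nu> \<nu>) / 2"
  define X where "X = en \<mu> \<nu> - q * en \<nu> \<sigma> - k * frostman \<mu>"
  have k: "0 \<le> k" by (simp add: k_def)
  have fe: "finite_energy \<mu>" and mass: "measure \<mu> UNIV = 1" using \<mu> by (auto simp: equilibrium_def)
  have ge: "0 \<le> X + t * Y" if t: "0 < t" "t * k < 1" for t
  proof -
    have "J \<mu> \<le> J (comb (1 - t * k) \<mu> t \<nu>)"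
      using \<nu> fe mass t by (intro equilibriumD[OF \<mu>]) (auto simp: finite_energy_comb measure_UNIV_comb k_def)
    also have "\<dots> = J \<mu> + 2 * t * (X + t * Y)"
      using fe \<nu> t
      by (subst J_comb) (simp_all add: X_def Y_def J_def frostman_def power2_eq_square field_simps)
    finally show ?thesis using t by (simp add: zero_le_mult_iff)
  qed
  have "((\<lambda>t. X + t * Y) \<longlongrightarrow> X + 0 * Y) (at_right 0)"
    by (intro tendsto_intros)
  moreover have "\<forall>\<^sub>F t in at_right 0. 0 \<le> X + t * Y"
    unfolding eventually_at_right_field
  proof (intro exI[of _ "1 / (k + 1)"] conjI allI impI ge)
    fix t assume t: "0 < t" "t < 1 / (k + 1)"
    then have "t * (k + 1) < 1" using k by (simp add: field_simps)
    then show "t * k < 1" using t by (simp add: algebra_simps)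
  qed (use k in auto)
  ultimately have "0 \<le> X + 0 * Y"
    by (rule tendsto_lowerbound) simp
  then show ?thesis by (simp add: X_def k_def mult.commute)
qed

text \<open>Testing the variational inequality with \<sigma> bounds the squared distance from \<mu>
  to \<open>q\<sigma>\<close> by \<open>(1 - q) * frostman \<mu>\<close>. A nonnegative constant
  would make this at most 0 and \<mu> equal to \<open>q\<sigma>\<close>, which has the wrong
  mass.\<close>

lemma frostman_neg:
  assumes q: "1 < q" and \<mu>: "equilibrium \<mu>"
  shows "frostman \<mu> < 0"
proof (rule ccontr)
  assume *: "\<not> frostman \<mu> < 0"
  have fe: "finite_energy \<mu>" using \<mu> by (simp add: equilibrium_def)
  have "frostman \<mu> \<le> en \<mu> \<sigma> - q * en \<sigma> \<sigma>"
    using variational_inequality[OF \<mu> finite_energy_\<sigma>] by (simp add: measure_\<sigma>)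
  then have "q * frostman \<mu> \<le> q * (en \<mu> \<sigma> - q * en \<sigma> \<sigma>)"
    using q by (intro mult_left_mono) auto
  moreover have "J \<mu> + q\<^sup>2 * en \<sigma> \<sigma> = frostman \<mu> - q * (en \<mu> \<sigma> - q * en \<sigma> \<sigma>)"
    by (simp add: J_def frostman_def power2_eq_square algebra_simps)
  moreover have "frostman \<mu> \<le> q * frostman \<mu>" using * q by (simp add: mult_le_cancel_right1)
  ultimately have "\<mu> = q\<sigma>" using fe by (intro J_minimal_imp_eq) auto
  then show False using \<mu> q measure_q\<sigma> by (auto simp: equilibrium_def)
qed

end

subsection \<open>The support of the equilibrium measure\<close>

lemma measure_support_closed: "closed (measure_support \<mu>)" if "sets \<mu> = sets borel"
proof -
  have "\<exists>e>0. ball x e \<subseteq> - measure_support \<mu>" if x: "x \<in> - measure_support \<mu>" for x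
  proof -
    obtain e where e: "0 < e" "emeasure \<mu> (ball x e) = 0"
      using x by (auto simp: measure_support_def)
    have "y \<notin> measure_support \<mu>" if "y \<in> ball x e" for y
    proof -
      have "ball y (e - dist x y) \<subseteq> ball x e"
        by (auto simp: dist_real_def)
      then have "emeasure \<mu> (ball y (e - dist x y)) \<le> emeasure \<mu> (ball x e)"
        using \<open>sets \<mu> = sets borel\<close> by (intro emeasure_mono) auto
      then show ?thesis using e that by (force simp: measure_support_def)
    qed
    then show ?thesis using e by blast
  qed
  then show ?thesis by (simp add: closed_def open_contains_ball)
qed

text \<open>Null balls cover \<open>U\<close>, but possibly uncountably many of them; Lindelof's
  theorem selects a countable subfamily with the same union.\<close>

lemma emeasure_open_disjoint_support:
  assumes sets: "sets \<mu> = sets borel" and "open U" "U \<inter> measure_support \<mu> = {}"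
  shows "emeasure \<mu> U = 0"
proof -
  define \<F> where "\<F> = {ball x e |x e. emeasure \<mu> (ball x e) = 0}"
  obtain \<G> where \<G>: "\<G> \<subseteq> \<F>" "countable \<G>" "\<Union>\<G> = \<Union>\<F>"
    by (rule Lindelof[of \<F>]) (auto simp: \<F>_def)
  have "U \<subseteq> \<Union>\<F>"
  proof
    fix x assume "x \<in> U"
    then obtain e where "0 < e" "emeasure \<mu> (ball x e) = 0" using assms(3) by (auto simp: measure_support_def)
    then show "x \<in> \<Union>\<F>" by (auto simp: \<F>_def intro!: exI[of _ "ball x e"])
  qed
  moreover have "(\<Union>G\<in>\<G>. G) \<in> null_sets \<mu>"
  proof (rule null_sets_UN')
    fix G assume "G \<in> \<G>"
    then obtain x e where "G = ball x e" "emeasure \<mu> (ball x e) = 0" using \<G>(1) by (auto simp: \<F>_def)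
    then show "G \<in> null_sets \<mu>" using sets by auto
  qed (rule \<G>)
  ultimately have "U \<in> null_sets \<mu>"
    using \<G>(3) sets \<open>open U\<close> null_sets_subset[of "\<Union>\<G>" \<mu> U] by simp
  then show ?thesis by auto
qed

lemma isCont_eventually_less:
  fixes f :: "real \<Rightarrow> real"
  assumes "isCont f x" "f x < c"
  shows "\<forall>\<^sub>F x' in nhds x. f x' < c"
  using assms unfolding isCont_def tendsto_at_iff_tendsto_nhds by (rule order_tendstoD)

text \<open>A point missing between \<open>Inf S\<close> and \<open>Sup S\<close> would lie in the
  gap between the largest point of \<open>S\<close> below it and the smallest one above it.\<close>

lemma gap_free_imp_interval:
  fixes S :: "real set"
  assumes "closed S" "bounded S" "S \<noteq> {}"
    and no_gap: "\<And>\<alpha> \<beta>. \<lbrakk>\<alpha> < \<beta>; \<alpha> \<in> S; \<beta> \<in> S; {\<alpha><..<\<beta>} \<inter> S = {}\<rbrakk> \<Longrightarrow> False"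
  shows "\<exists>a b. a \<le> b \<and> S = {a..b}"
proof -
  have bdd: "bdd_below T" "bdd_above T" if "T \<subseteq> S" for T
    using bounded_subset[OF assms(2) that] by (auto simp: bounded_imp_bdd_below bounded_imp_bdd_above)
  define a b where "a = Inf S" and "b = Sup S"
  have a: "a \<in> S" and b: "b \<in> S"
    using assms bdd[of S] by (auto simp: a_def b_def closed_contains_Inf closed_contains_Sup)
  have sub: "S \<subseteq> {a..b}"
    using bdd[of S] by (auto simp: a_def b_def cInf_lower cSup_upper)
  have "{a..b} \<subseteq> S"
  proof (rule subsetI, rule ccontr)
    fix x assume x: "x \<in> {a..b}"
    assume "x \<notin> S"
    let ?L = "S \<inter> {..x}" and ?R = "S \<inter> {x..}"
    have "Sup ?L \<in> ?L" "Inf ?R \<in> ?R"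
      using a b x by (intro closed_contains_Sup closed_contains_Inf closed_Int assms bdd closed_atMost closed_atLeast; auto)+
    moreover from this have "Sup ?L < x" "x < Inf ?R" using \<open>x \<notin> S\<close> by (force simp: less_le)+
    moreover have "y \<le> Sup ?L \<or> Inf ?R \<le> y" if "y \<in> S" for y
      using that bdd[of ?L] bdd[of ?R] by (cases "y \<le> x") (auto intro!: cSup_upper cInf_lower)
    ultimately show False
      using no_gap[of "Sup ?L" "Inf ?R"] by force
  qed
  then show ?thesis using sub a by (intro exI[of _ a] exI[of _ b]) auto
qed

context riesz
begin

text \<open>In this form the kernel is continuous in \<open>x\<close> as an extended real function,
  including at the diagonal.\<close>

lemma riesz_kernel_eq_inverse: "riesz_kernel s x y = inverse (ennreal (\<bar>x - y\<bar> powr s))"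
  using s_pos by (auto simp: riesz_kernel_def inverse_ennreal powr_minus)

lemma tendsto_riesz_kernel:
  assumes "X \<longlonglongrightarrow> x"
  shows "(\<lambda>n. riesz_kernel s (X n) y) \<longlonglongrightarrow> riesz_kernel s x y"
proof -
  have "continuous_on UNIV (\<lambda>x. ennreal (\<bar>x - y\<bar> powr s))"
    using s_pos by (intro continuous_on_ennreal continuous_on_powr' continuous_intros) auto
  then have "continuous_on UNIV (\<lambda>x. inverse (ennreal (\<bar>x - y\<bar> powr s)))"
    by (rule continuous_on_inverse_ennreal)
  then show ?thesis
    unfolding riesz_kernel_eq_inverse
    using assms by (rule continuous_on_tendsto_compose) auto
qed

text \<open>Fatou's lemma along sequences tending to \<open>x\<close>, using pointwise convergence
  of the kernel.\<close>

lemma potential_lsc: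
  assumes \<mu>: "finite_borel_measure \<mu>" and less: "k < potential \<mu> x"
  shows "\<forall>\<^sub>F x' in nhds x. k < potential \<mu> x'"
proof -
  interpret finite_borel_measure \<mu> by fact
  note M_is_borel[measurable_cong]
  have "\<forall>\<^sub>F n in sequentially. k < potential \<mu> (X n)" if X: "X \<longlonglongrightarrow> x" for X
  proof -
    have "potential \<mu> x = (\<integral>\<^sup>+y. liminf (\<lambda>n. riesz_kernel s (X n) y) \<partial>\<mu>)"
      unfolding potential_def
      by (intro nn_integral_cong lim_imp_Liminf[symmetric] tendsto_riesz_kernel X) auto
    also have "\<dots> \<le> liminf (\<lambda>n. potential \<mu> (X n))"
      unfolding potential_def by (rule nn_integral_liminf) measurable
    finally show ?thesis by (intro less_LiminfD less_le_trans[OF less])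
  qed
  then have "\<forall>\<^sub>F x' in inf (nhds x) (principal UNIV). k < potential \<mu> x'"
    by (intro sequentially_imp_eventually_nhds_within) auto
  then show ?thesis by simp
qed

text \<open>In the interval representation the energy is visibly monotone in the measure.\<close>

lemma finite_energy_mono:
  assumes \<mu>: "finite_energy \<mu>" and sets: "sets \<nu> = sets borel"
    and le: "\<And>A. A \<in> sets borel \<Longrightarrow> emeasure \<nu> A \<le> emeasure \<mu> A"
  shows "finite_energy \<nu>"
proof -
  interpret m: finite_borel_measure \<mu> using \<mu> by (simp add: finite_energy_def)
  have "emeasure \<nu> UNIV < \<infinity>"
    by (rule le_less_trans[OF le]) (simp_all add: m.emeasure_eq_measure)
  then have \<nu>: "finite_borel_measure \<nu>"
    using sets sets_eq_imp_space_eq[OF sets] by (intro finite_borel_measureI finite_measureI) auto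
  have "energy \<nu> \<nu> \<le> energy \<mu> \<mu>"
    unfolding energy_eq_nn_integral[OF \<nu> \<nu>] energy_eq_nn_integral[OF m.finite_borel_measure_axioms m.finite_borel_measure_axioms]
    by (intro nn_integral_mono mult_mono le) auto
  then show ?thesis using \<nu> \<mu> by (auto simp: finite_energy_def intro: le_less_trans)
qed

definition restr :: "real measure \<Rightarrow> real set \<Rightarrow> real measure" where
  "restr \<mu> B = density \<mu> (indicator B)"

lemma emeasure_restr:
  assumes "sets \<mu> = sets borel" "B \<in> sets borel" "A \<in> sets borel"
  shows "emeasure (restr \<mu> B) A = emeasure \<mu> (B \<inter> A)"
  unfolding restr_def using assms by (intro emeasure_restricted) auto

lemma sets_restr [simp]: "sets (restr \<mu> B) = sets \<mu>"
  by (simp add: restr_def)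

lemma finite_energy_restr:
  assumes \<mu>: "finite_energy \<mu>" and B: "B \<in> sets borel"
  shows "finite_energy (restr \<mu> B)"
proof -
  have s: "sets \<mu> = sets borel" using \<mu> by (simp add: finite_energy_def finite_borel_measure.M_is_borel)
  show ?thesis
    using \<mu> s B by (intro finite_energy_mono[OF \<mu>]) (auto simp: emeasure_restr intro!: emeasure_mono)
qed

lemma comb_restr:
  assumes s: "sets \<mu> = sets borel" and B: "B \<in> sets borel"
  shows "comb 1 (restr \<mu> B) 1 (restr \<mu> (- B)) = \<mu>"
proof (rule measure_eqI)
  fix A assume "A \<in> sets (comb 1 (restr \<mu> B) 1 (restr \<mu> (- B)))"
  then have A: "A \<in> sets borel" by simp
  have "emeasure \<mu> A = emeasure \<mu> (B \<inter> A) + emeasure \<mu> (- B \<inter> A)"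
    using A B s by (subst plus_emeasure) (auto intro!: arg_cong[of _ _ "emeasure \<mu>"])
  then show "emeasure (comb 1 (restr \<mu> B) 1 (restr \<mu> (- B))) A = emeasure \<mu> A"
    using A B s by (simp add: emeasure_comb emeasure_restr)
qed (simp add: s)

end

section \<open>Pointwise Frostman conditions\<close>

context riesz_field_strength
begin

lemma nn_integral_w_powr:
  assumes "finite_energy \<nu>" and d: "0 \<le> d"
  shows "(\<integral>\<^sup>+x. ennreal (q * w x powr (- s) + d) \<partial>\<nu>) = ennreal (q * en \<nu> \<sigma> + d * measure \<nu> UNIV)"
proof -
  interpret finite_borel_measure \<nu> using assms by (simp add: finite_energy_def)
  note M_is_borel[measurable_cong]
  have "(\<integral>\<^sup>+x. ennreal (q * w x powr (- s) + d) \<partial>\<nu>) = (\<integral>\<^sup>+x. ennreal q * ennreal (w x powr (- s)) + ennreal d \<partial>\<nu>)"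
    using q_pos d by (simp add: ennreal_mult)
  also have "\<dots> = ennreal q * energy \<nu> \<sigma> + ennreal d * emeasure \<nu> UNIV"
    by (simp add: nn_integral_add nn_integral_cmult energy_\<sigma>_eq borel_UNIV)
  also have "\<dots> = ennreal (q * en \<nu> \<sigma> + d * measure \<nu> UNIV)"
    using q_pos d assms
    by (simp add: ennreal_mult en_nonneg ennreal_en finite_energy_\<sigma> emeasure_eq_measure)
  finally show ?thesis .
qed

lemma nn_integral_potential:
  assumes "finite_energy \<mu>" "finite_energy \<nu>" "0 \<le> d"
  shows "(\<integral>\<^sup>+x. potential \<mu> x + ennreal d \<partial>\<nu>) = ennreal (en \<mu> \<nu> + d * measure \<nu> UNIV)"
proof -
  interpret finite_borel_measure \<nu> using assms by (simp add: finite_energy_def)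
  note M_is_borel[measurable_cong]
  have [measurable]: "potential \<mu> \<in> borel_measurable borel"
    using assms by (intro measurable_potential) (simp add: finite_energy_def)
  have "(\<integral>\<^sup>+x. potential \<mu> x + ennreal d \<partial>\<nu>) = energy \<nu> \<mu> + ennreal d * emeasure \<nu> UNIV"
    by (simp add: nn_integral_add energy_def borel_UNIV)
  also have "\<dots> = ennreal (en \<mu> \<nu> + d * measure \<nu> UNIV)"
    using assms by (simp add: ennreal_mult en_nonneg ennreal_en en_commute[of \<mu>] emeasure_eq_measure)
  finally show ?thesis .
qed

text \<open>Writing the negative Frostman constant as \<open>- f\<close> lets both conditions be
  stated in \<open>ennreal\<close> with nonnegative terms and no subtraction.\<close>

context
  fixes \<mu> f
  assumes \<mu>: "equilibrium \<mu>" and f_eq: "frostman \<mu> = - f" and f_pos: "0 < f"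
begin

text \<open>A violation at \<open>x\<close> persists with a margin on a ball by lower
  semicontinuity, and the ball has positive mass. Integrate it over the part of \<mu> in the ball
  and apply the variational inequality to the rest: the sum contradicts the value of
  \<open>frostman \<mu>\<close>.\<close>

lemma potential_le_on_support:
  assumes x: "x \<in> measure_support \<mu>"
  shows "potential \<mu> x + ennreal f \<le> ennreal (q * w x powr (- s))"
proof (rule ccontr)
  assume "\<not> ?thesis"
  then have less: "ennreal (q * w x powr (- s)) < potential \<mu> x + ennreal f" by simp
  interpret finite_borel_measure \<mu> by (rule equilibrium_finite_borel[OF \<mu>])
  obtain c where c: "ennreal (q * w x powr (- s)) < ennreal c" "ennreal c < potential \<mu> x + ennreal f"
    using dense[OF less] by (metis ennreal_cases top.extremum_strict)
  have c': "q * w x powr (- s) < c"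
    using c(1) q_pos by (simp add: ennreal_less_iff)
  \<comment> \<open>Half of the difference is kept as the margin that survives integration.\<close>
  define d where "d = (c - q * w x powr (- s)) / 2"
  have d: "0 < d" "q * w x powr (- s) < c - d" using c' by (auto simp: d_def field_simps)
  have "isCont w x" using continuous_on_w[OF continuous_on_id, of UNIV] by (simp add: continuous_on_eq_continuous_at)
  then have "isCont (\<lambda>x. q * w x powr (- s)) x"
    using w_pos[of x] by (intro continuous_intros) auto
  then have "\<forall>\<^sub>F x' in nhds x. q * w x' powr (- s) < c - d"
    using d(2) by (rule isCont_eventually_less)
  \<comment> \<open>Semicontinuity concerns the potential alone, so \<open>f\<close> is subtracted
    from \<open>c\<close>. If \<open>c < f\<close>, this is not possible, but then the claim is
    immediate.\<close>
  moreover have "\<forall>\<^sub>F x' in nhds x. ennreal c < potential \<mu> x' + ennreal f"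
  proof (cases "c < f")
    case True
    then have "ennreal c < ennreal f" using f_pos by (intro ennreal_lessI)
    then have "ennreal c < potential \<mu> x' + ennreal f" for x'
      by (rule less_le_trans) simp
    then show ?thesis by simp
  next
    case False
    have *: "ennreal c = ennreal (c - f) + ennreal f" using False f_pos by (simp add: ennreal_plus[symmetric] del: ennreal_plus)
    have "\<forall>\<^sub>F x' in nhds x. ennreal (c - f) < potential \<mu> x'"
      using c(2) unfolding * by (intro potential_lsc[OF equilibrium_finite_borel[OF \<mu>]]) (simp add: ennreal_add_left_cancel_less add.commute)
    then show ?thesis
      by eventually_elim (simp add: * ennreal_add_left_cancel_less add.commute)
  qed
  ultimately have "\<forall>\<^sub>F x' in nhds x. ennreal (q * w x' powr (- s) + d) \<le> potential \<mu> x' + ennreal f"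
    by eventually_elim (meson add_less_le_mono ennreal_leI less_diff_eq less_imp_le order_trans)
  then obtain e where e: "0 < e" "\<And>x'. dist x' x < e \<Longrightarrow> ennreal (q * w x' powr (- s) + d) \<le> potential \<mu> x' + ennreal f"
    by (auto simp: eventually_nhds_metric)
  note fe = equilibrium_finite_energy[OF \<mu>]
  define B where "B = ball x e"
  have B: "B \<in> sets borel" by (simp add: B_def)
  define \<nu>1 \<nu>2 where "\<nu>1 = restr \<mu> B" and "\<nu>2 = restr \<mu> (- B)"
  have fe12: "finite_energy \<nu>1" "finite_energy \<nu>2"
    using fe B by (auto simp: \<nu>1_def \<nu>2_def finite_energy_restr)
  have split: "\<mu> = comb 1 \<nu>1 1 \<nu>2" using comb_restr[OF M_is_borel B] by (simp add: \<nu>1_def \<nu>2_def)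
  have pos: "0 < measure \<nu>1 UNIV"
  proof -
    have "emeasure \<nu>1 UNIV = emeasure \<mu> (ball x e)"
      using B by (simp add: \<nu>1_def emeasure_restr M_is_borel B_def)
    also have "\<dots> \<noteq> 0" using x e by (simp add: measure_support_def)
    finally have "measure \<nu>1 UNIV \<noteq> 0"
      using fe12(1) by (simp add: finite_energy_def finite_borel_measure_def finite_measure.emeasure_eq_measure)
    then show ?thesis by (simp add: zero_less_measure_iff)
  qed
  have "AE x' in \<nu>1. ennreal (q * w x' powr (- s) + d) \<le> potential \<mu> x' + ennreal f"
    unfolding \<nu>1_def restr_def using B e(2)
    by (subst AE_density) (auto simp: M_is_borel B_def dist_commute intro!: borel_measurable_indicator split: split_indicator)
  then have "ennreal (q * en \<nu>1 \<sigma> + d * measure \<nu>1 UNIV) \<le> ennreal (en \<mu> \<nu>1 + f * measure \<nu>1 UNIV)"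
    using fe12 fe d f_pos
    by (simp only: nn_integral_w_powr[symmetric] nn_integral_potential[symmetric] less_imp_le nn_integral_mono_AE)
  then have "q * en \<nu>1 \<sigma> + d * measure \<nu>1 UNIV \<le> en \<mu> \<nu>1 + f * measure \<nu>1 UNIV"
    using f_pos by (subst (asm) ennreal_le_iff) (auto simp: en_nonneg)
  moreover have "- f * measure \<nu>2 UNIV \<le> en \<mu> \<nu>2 - q * en \<nu>2 \<sigma>"
    using variational_inequality[OF \<mu> fe12(2)] by (simp add: f_eq)
  moreover have "en \<mu> \<mu> = en \<mu> \<nu>1 + en \<mu> \<nu>2"
    using en_comb_right[OF fe12 fe, of 1 1] by (simp add: split[symmetric])
  moreover have "q * en \<mu> \<sigma> = q * en \<nu>1 \<sigma> + q * en \<nu>2 \<sigma>"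
    using en_comb_left[OF fe12 finite_energy_\<sigma>, of 1 1] by (simp add: split[symmetric] distrib_left)
  moreover have "f * measure \<nu>1 UNIV + f * measure \<nu>2 UNIV = f"
    using measure_UNIV_comb[OF fe12, of 1 1]
    by (simp add: split[symmetric] equilibrium_mass[OF \<mu>] distrib_left[symmetric])
  moreover have "en \<mu> \<mu> - q * en \<mu> \<sigma> = - f" using f_eq by (simp add: frostman_def)
  moreover have "0 < d * measure \<nu>1 UNIV" using d pos by simp
  ultimately show False by linarith
qed

text \<open>Almost every \<open>y\<close> has distance at least \<open>d\<close> from
  \<open>x\<close>, so replacing \<open>x\<close> by \<open>x'\<close> shrinks the distance to
  \<open>y\<close> at most by the factor \<open>1 - \<bar>x' - x\<bar> / d\<close>. This gives the
  upper semicontinuity needed off the support.\<close>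

lemma potential_off_support:
  assumes d: "0 < d" "emeasure \<mu> (ball x d) = 0" and x': "\<bar>x' - x\<bar> < d"
  shows "potential \<mu> x' \<le> ennreal ((1 - \<bar>x' - x\<bar> / d) powr (- s)) * potential \<mu> x"
proof -
  interpret finite_borel_measure \<mu> by (rule equilibrium_finite_borel[OF \<mu>])
  note M_is_borel[measurable_cong]
  define r where "r = 1 - \<bar>x' - x\<bar> / d"
  have r: "0 < r" using d x' by (simp add: r_def)
  have "ball x d \<in> null_sets \<mu>" using d by (auto simp: M_is_borel)
  then have "AE y in \<mu>. y \<notin> ball x d" by (rule AE_not_in)
  then have AE: "AE y in \<mu>. riesz_kernel s x' y \<le> ennreal (r powr (- s)) * riesz_kernel s x y"
  proof eventually_elim
    case (elim y)
    then have y: "d \<le> \<bar>x - y\<bar>" by (simp add: dist_real_def)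
    have "\<bar>x' - x\<bar> / d * d \<le> \<bar>x' - x\<bar> / d * \<bar>x - y\<bar>"
      using d y by (intro mult_left_mono) auto
    then have "r * \<bar>x - y\<bar> \<le> \<bar>x' - y\<bar>" using d by (simp add: r_def algebra_simps)
    moreover have "0 < r * \<bar>x - y\<bar>" using r y d by simp
    ultimately have "\<bar>x' - y\<bar> powr (- s) \<le> (r * \<bar>x - y\<bar>) powr (- s)" "0 < \<bar>x' - y\<bar>"
      using s_pos by (auto intro!: powr_mono2')
    then show ?case using y d r
      by (auto simp: riesz_kernel_def ennreal_mult[symmetric] powr_mult intro!: ennreal_leI)
  qed
  show ?thesis
    unfolding potential_def r_def[symmetric] using AE
    by (subst nn_integral_cmult[symmetric]) (auto intro: nn_integral_mono_AE)
qed

text \<open>Off the support a violation spreads to a short interval, whose uniform measure has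
  finite energy and contradicts the variational inequality. Hence there is no exceptional set
  here.\<close>

lemma potential_ge_off_support:
  assumes x: "x \<notin> measure_support \<mu>"
  shows "ennreal (q * w x powr (- s)) \<le> potential \<mu> x + ennreal f"
proof (rule ccontr)
  assume "\<not> ?thesis"
  then have less: "potential \<mu> x + ennreal f < ennreal (q * w x powr (- s))" by simp
  then have "potential \<mu> x < \<infinity>" by (metis ennreal_add_eq_top infinity_ennreal_def less_top not_less_iff_gr_or_eq top.extremum_strict)
  then obtain u where u: "0 \<le> u" "potential \<mu> x = ennreal u" by (cases "potential \<mu> x") auto
  have u_less: "u + f < q * w x powr (- s)"
    using less u f_pos q_pos by (simp add: ennreal_plus[symmetric] ennreal_less_iff del: ennreal_plus)
  obtain d where d: "0 < d" "emeasure \<mu> (ball x d) = 0" using x by (auto simp: measure_support_def)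
  \<comment> \<open>A continuous upper bound near \<open>x\<close> for the potential plus
    \<open>f\<close> minus \<open>q * w x' powr (- s)\<close>; its negative value at
    \<open>x\<close> leaves a uniform margin \<delta> nearby.\<close>
  define h where "h x' = (1 - \<bar>x' - x\<bar> / d) powr (- s) * u + f - q * w x' powr (- s)" for x'
  define \<delta> where "\<delta> = - h x / 2"
  have "h x < 0" using u_less by (simp add: h_def)
  then have \<delta>: "0 < \<delta>" "h x < - \<delta>" by (auto simp: \<delta>_def)
  have "isCont w x" using continuous_on_w[OF continuous_on_id, of UNIV] by (simp add: continuous_on_eq_continuous_at)
  then have "isCont h x"
    unfolding h_def using w_pos[of x] d by (intro continuous_intros) auto
  then have "\<forall>\<^sub>F x' in nhds x. h x' < - \<delta>"
    using \<delta>(2) by (rule isCont_eventually_less)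
  then obtain e where e: "0 < e" "\<And>x'. dist x' x < e \<Longrightarrow> h x' < - \<delta>"
    by (auto simp: eventually_nhds_metric)
  define L where "L = min (e / 2) (d / 2)"
  have L: "0 < L" using e d by (simp add: L_def)
  define \<nu> where "\<nu> = unif x L"
  have \<nu>: "finite_energy \<nu>" using L by (simp add: \<nu>_def finite_energy_unif)
  have m\<nu>: "measure \<nu> UNIV = 1"
    using prob_space.prob_space[OF prob_space_unif[OF L, of x]] by (simp add: \<nu>_def unif_def)
  have "AE x' in \<nu>. potential \<mu> x' + ennreal (f + \<delta>) \<le> ennreal (q * w x' powr (- s) + 0)"
    unfolding \<nu>_def unif_def
  proof (rule AE_uniform_measureI, simp, rule AE_I2, rule impI)
    fix x' assume "x' \<in> {x..x + L}"
    then have x': "\<bar>x' - x\<bar> < d" "dist x' x < e" using L e d by (auto simp: L_def dist_real_def)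
    have "potential \<mu> x' + ennreal (f + \<delta>) \<le> ennreal ((1 - \<bar>x' - x\<bar> / d) powr (- s) * u) + ennreal (f + \<delta>)"
      using potential_off_support[OF d x'(1)] u by (intro add_right_mono) (simp add: ennreal_mult)
    also have "\<dots> = ennreal ((1 - \<bar>x' - x\<bar> / d) powr (- s) * u + (f + \<delta>))"
      using u f_pos \<delta> by (intro ennreal_plus[symmetric]) auto
    also have "\<dots> \<le> ennreal (q * w x' powr (- s) + 0)"
      using e(2)[OF x'(2)] by (intro ennreal_leI) (simp add: h_def)
    finally show "potential \<mu> x' + ennreal (f + \<delta>) \<le> ennreal (q * w x' powr (- s) + 0)" .
  qed
  then have "ennreal (en \<mu> \<nu> + (f + \<delta>) * measure \<nu> UNIV) \<le> ennreal (q * en \<nu> \<sigma> + 0 * measure \<nu> UNIV)"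
    using \<nu> equilibrium_finite_energy[OF \<mu>] \<delta> f_pos
    by (simp only: nn_integral_w_powr[symmetric] nn_integral_potential[symmetric] less_imp_le add_nonneg_nonneg
        order_refl nn_integral_mono_AE)
  then have "en \<mu> \<nu> + f + \<delta> \<le> q * en \<nu> \<sigma>"
    using q_pos by (subst (asm) ennreal_le_iff) (auto simp: en_nonneg m\<nu>)
  then show False
    using variational_inequality[OF \<mu> \<nu>] \<delta> by (simp add: f_eq m\<nu>)
qed

end

end

section \<open>Convexity in the angle at which \<open>z\<close> sees a point\<close>

context riesz_field
begin

text \<open>If \<open>x = Re z + \<bar>Im z\<bar> tan \<theta>\<close>, this is the point whose angle is the mean of the angles of \<open>\<alpha>\<close> and \<open>\<beta>\<close>;
  in the variable \<open>\<theta>\<close> the function \<open>w x powr s * riesz_kernel s x y\<close> is convex off \<open>y\<close>.\<close>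

definition midpt :: "real \<Rightarrow> real \<Rightarrow> real" where
  "midpt \<alpha> \<beta> = (\<alpha> * w \<beta> + \<beta> * w \<alpha>) / (w \<alpha> + w \<beta>)"

lemma midpt_between:
  assumes "\<alpha> < \<beta>"
  shows "\<alpha> < midpt \<alpha> \<beta>" "midpt \<alpha> \<beta> < \<beta>"
proof -
  have "\<alpha> * w \<alpha> < \<beta> * w \<alpha>" "\<alpha> * w \<beta> < \<beta> * w \<beta>" using assms w_pos by auto
  then show "\<alpha> < midpt \<alpha> \<beta>" "midpt \<alpha> \<beta> < \<beta>"
    using w_pos[of \<alpha>] w_pos[of \<beta>] by (auto simp: midpt_def field_simps)
qed

text \<open>In terms of angles the ratio of the two sides is the squared cosine of half the
  difference of the angles of \<alpha> and \<beta>. Algebraically, \<open>P\<close> is the inner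
  product of the vectors from \<open>z\<close> to the two points, and \<open>P < A * B\<close> is
  the strict Cauchy-Schwarz inequality.\<close>

lemma w_midpt:
  assumes "\<alpha> < \<beta>"
  shows "(w (midpt \<alpha> \<beta>) * (w \<alpha> + w \<beta>))\<^sup>2 < (2 * w \<alpha> * w \<beta>)\<^sup>2"
proof -
  define A B where "A = w \<alpha>" and "B = w \<beta>"
  define a b where "a = \<alpha> - Re z" and "b = \<beta> - Re z"
  have AB: "0 < A" "0 < B" using w_pos by (auto simp: A_def B_def)
  have A2: "A\<^sup>2 = a\<^sup>2 + (Im z)\<^sup>2" and B2: "B\<^sup>2 = b\<^sup>2 + (Im z)\<^sup>2"
    by (simp_all add: A_def B_def a_def b_def w_square)
  define P where "P = a * b + (Im z)\<^sup>2"
  have "(A * B)\<^sup>2 = P\<^sup>2 + (Im z)\<^sup>2 * (a - b)\<^sup>2"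
    unfolding power_mult_distrib A2 B2 P_def by (simp add: power2_eq_square algebra_simps)
  moreover have "0 < (Im z)\<^sup>2 * (a - b)\<^sup>2" using Im_z assms by (simp add: a_def b_def)
  ultimately have "P\<^sup>2 < (A * B)\<^sup>2" by simp
  then have P: "P < A * B" by (rule power2_less_imp_less) (use AB in simp)
  have "(midpt \<alpha> \<beta> - Re z) * (A + B) = a * B + b * A"
    using AB by (simp add: midpt_def A_def[symmetric] B_def[symmetric] a_def b_def field_simps)
  then have "(w (midpt \<alpha> \<beta>) * (A + B))\<^sup>2 = (a * B + b * A)\<^sup>2 + (Im z)\<^sup>2 * (A + B)\<^sup>2"
    by (simp add: power_mult_distrib w_square distrib_right) (simp add: power_mult_distrib[symmetric])
  also have "\<dots> = B\<^sup>2 * (a\<^sup>2 + (Im z)\<^sup>2) + A\<^sup>2 * (b\<^sup>2 + (Im z)\<^sup>2) + 2 * (A * B) * P"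
    by (simp add: P_def power2_eq_square algebra_simps)
  also have "\<dots> = B\<^sup>2 * A\<^sup>2 + A\<^sup>2 * B\<^sup>2 + 2 * (A * B) * P"
    by (simp only: A2 B2)
  also have "\<dots> < B\<^sup>2 * A\<^sup>2 + A\<^sup>2 * B\<^sup>2 + 2 * (A * B) * (A * B)"
    using P AB by simp
  also have "\<dots> = (2 * A * B)\<^sup>2" by (simp add: power2_eq_square)
  finally show ?thesis by (simp add: A_def B_def)
qed

text \<open>Strict midpoint log-convexity of \<open>w\<close> in the angle, from
  \<open>w_midpt\<close> and the inequality of arithmetic and geometric means.\<close>

lemma w_midpt_less:
  assumes "\<alpha> < \<beta>"
  shows "(w (midpt \<alpha> \<beta>))\<^sup>2 < w \<alpha> * w \<beta>"
proof -
  have pos: "0 < w \<alpha>" "0 < w \<beta>" "0 < w \<alpha> * w \<beta>" using w_pos by auto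
  have "0 \<le> (w \<alpha> - w \<beta>)\<^sup>2" by simp
  then have "4 * (w \<alpha> * w \<beta>) \<le> (w \<alpha> + w \<beta>)\<^sup>2" by (simp add: power2_eq_square algebra_simps)
  then have "4 * (w \<alpha> * w \<beta>) * (w \<alpha> * w \<beta>) \<le> (w \<alpha> + w \<beta>)\<^sup>2 * (w \<alpha> * w \<beta>)"
    using pos by (intro mult_right_mono) auto
  with w_midpt[OF assms] have "(w (midpt \<alpha> \<beta>))\<^sup>2 * (w \<alpha> + w \<beta>)\<^sup>2 < (w \<alpha> * w \<beta>) * (w \<alpha> + w \<beta>)\<^sup>2"
    by (simp add: power_mult_distrib power2_eq_square mult_ac)
  then show ?thesis using pos by (simp add: mult_less_cancel_right)
qed

text \<open>Midpoint log-convexity of \<open>w x / \<bar>x - y\<bar>\<close> in the angle,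
  multiplied out so that \<open>y\<close> may be an end point. Both end points lie on the same side
  of \<open>y\<close>, so \<open>p * r\<close> is nonnegative and the arithmetic-geometric mean
  inequality applies.\<close>

lemma w_midpt_mult:
  assumes "\<alpha> < \<beta>" and y: "y \<le> \<alpha> \<or> \<beta> \<le> y"
  shows "(w (midpt \<alpha> \<beta>))\<^sup>2 * (\<bar>\<alpha> - y\<bar> * \<bar>\<beta> - y\<bar>) \<le> (midpt \<alpha> \<beta> - y)\<^sup>2 * (w \<alpha> * w \<beta>)"
proof -
  define A B where "A = w \<alpha>" and "B = w \<beta>"
  define m where "m = midpt \<alpha> \<beta>"
  define p r where "p = \<alpha> - y" and "r = \<beta> - y"
  have AB: "0 < A" "0 < B" using w_pos by (auto simp: A_def B_def)
  have pr: "0 \<le> p * r" using assms by (auto simp: p_def r_def zero_le_mult_iff)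
  have n: "(m - y) * (A + B) = p * B + r * A"
    using AB by (simp add: m_def midpt_def A_def[symmetric] B_def[symmetric] p_def r_def field_simps)
  have "0 \<le> (p * B - r * A)\<^sup>2" by simp
  then have amgm: "4 * (p * r) * (A * B) \<le> ((m - y) * (A + B))\<^sup>2"
    unfolding n by (simp add: power2_eq_square algebra_simps)
  have "(w m)\<^sup>2 * (p * r) * (A + B)\<^sup>2 \<le> (2 * A * B)\<^sup>2 * (p * r)"
    using mult_right_mono[OF less_imp_le[OF w_midpt[OF assms(1)]] pr]
    by (simp add: A_def B_def m_def power_mult_distrib mult_ac)
  also have "\<dots> = 4 * (p * r) * (A * B) * (A * B)" by (simp add: power2_eq_square)
  also have "\<dots> \<le> ((m - y) * (A + B))\<^sup>2 * (A * B)"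
    using AB by (intro mult_right_mono amgm) auto
  also have "\<dots> = (m - y)\<^sup>2 * (A * B) * (A + B)\<^sup>2" by (simp add: power_mult_distrib mult_ac)
  finally have "(w m)\<^sup>2 * (p * r) \<le> (m - y)\<^sup>2 * (A * B)" using AB by (simp add: mult_le_cancel_right)
  then show ?thesis
    using pr by (simp add: m_def A_def B_def p_def r_def abs_mult[symmetric])
qed

text \<open>Raise the log-convexity inequality to the power \<open>s\<close> and bound the geometric
  mean by the arithmetic mean. If \<open>y\<close> is an end point, the right side is
  infinite.\<close>

lemma kernel_midpt:
  assumes "\<alpha> < \<beta>" and y: "y \<le> \<alpha> \<or> \<beta> \<le> y"
  shows "ennreal (w (midpt \<alpha> \<beta>) powr s) * riesz_kernel s (midpt \<alpha> \<beta>) y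
    \<le> ennreal (w \<alpha> powr s / 2) * riesz_kernel s \<alpha> y + ennreal (w \<beta> powr s / 2) * riesz_kernel s \<beta> y"
proof (cases "y = \<alpha> \<or> y = \<beta>")
  case True
  have "0 < w \<alpha> powr s / 2" "0 < w \<beta> powr s / 2" using w_pos[of \<alpha>] w_pos[of \<beta>] by auto
  then have "ennreal (w \<alpha> powr s / 2) * \<infinity> = \<infinity>" "ennreal (w \<beta> powr s / 2) * \<infinity> = \<infinity>"
    by (auto simp: ennreal_mult_top)
  then show ?thesis using True by (auto simp: riesz_kernel_def)
next
  case False
  define m where "m = midpt \<alpha> \<beta>"
  have m: "m \<noteq> y" using midpt_between[OF assms(1)] y by (auto simp: m_def)
  define X Y Z where "X = (w \<alpha> / \<bar>\<alpha> - y\<bar>) powr s" and "Y = (w \<beta> / \<bar>\<beta> - y\<bar>) powr s"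
    and "Z = (w m / \<bar>m - y\<bar>) powr s"
  have nz: "\<alpha> - y \<noteq> 0" "\<beta> - y \<noteq> 0" "m - y \<noteq> 0" using False m by auto
  have "(w m / \<bar>m - y\<bar>)\<^sup>2 \<le> (w \<alpha> / \<bar>\<alpha> - y\<bar>) * (w \<beta> / \<bar>\<beta> - y\<bar>)"
    using w_midpt_mult[OF assms] nz
    by (simp add: m_def power_divide divide_le_eq le_divide_eq field_simps zero_less_mult_iff)
  then have "((w m / \<bar>m - y\<bar>)\<^sup>2) powr s \<le> ((w \<alpha> / \<bar>\<alpha> - y\<bar>) * (w \<beta> / \<bar>\<beta> - y\<bar>)) powr s"
    using s_pos by (intro powr_mono2) auto
  then have "Z\<^sup>2 \<le> X * Y"
    using w_nonneg by (simp add: X_def Y_def Z_def power2_eq_square powr_mult[symmetric])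
  also have "\<dots> \<le> ((X + Y) / 2)\<^sup>2"
    using zero_le_power2[of "X - Y"] by (simp add: power2_eq_square field_simps)
  finally have "Z \<le> (X + Y) / 2"
    by (rule power2_le_imp_le) (simp add: X_def Y_def)
  moreover have rw: "w x powr s * \<bar>x - y\<bar> powr (- s) = (w x / \<bar>x - y\<bar>) powr s" if "x - y \<noteq> 0" for x
    using that w_nonneg[of x] by (simp add: powr_divide powr_minus field_simps)
  ultimately have "w m powr s * \<bar>m - y\<bar> powr (- s)
      \<le> w \<alpha> powr s / 2 * \<bar>\<alpha> - y\<bar> powr (- s) + w \<beta> powr s / 2 * \<bar>\<beta> - y\<bar> powr (- s)"
    using rw[OF nz(1)] rw[OF nz(2)] rw[OF nz(3)] by (simp add: X_def Y_def Z_def)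
  then show ?thesis
    using False m unfolding m_def[symmetric]
    by (simp add: riesz_kernel_def ennreal_mult[symmetric] ennreal_plus[symmetric] ennreal_leI del: ennreal_plus)
qed

end

context riesz_field_strength
begin

text \<open>The function \<open>w x powr s * (potential \<mu> x + f)\<close> is at most
  \<open>q\<close> at the ends of the gap and at least \<open>q\<close> at \<open>m\<close>.
  Convexity of the kernel over the gap, strict convexity of \<open>w powr s\<close> and
  \<open>f > 0\<close> make the value at \<open>m\<close> smaller than the mean of the end
  values.\<close>

lemma support_no_gap:
  assumes q: "1 < q" and \<mu>: "equilibrium \<mu>" and less: "\<alpha> < \<beta>"
    and supp: "\<alpha> \<in> measure_support \<mu>" "\<beta> \<in> measure_support \<mu>"
    and gap: "{\<alpha><..<\<beta>} \<inter> measure_support \<mu> = {}"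
  shows False
proof -
  define f where "f = - frostman \<mu>"
  have f: "frostman \<mu> = - f" "0 < f" using frostman_neg[OF q \<mu>] by (auto simp: f_def)
  note ge = potential_ge_off_support[OF \<mu> f] and le = potential_le_on_support[OF \<mu> f]
  interpret finite_borel_measure \<mu> by (rule equilibrium_finite_borel[OF \<mu>])
  note M_is_borel[measurable_cong]
  define m where "m = midpt \<alpha> \<beta>"
  have m: "m \<notin> measure_support \<mu>"
    using midpt_between[OF less] gap by (auto simp: m_def)
  have "{\<alpha><..<\<beta>} \<in> null_sets \<mu>"
    using emeasure_open_disjoint_support[OF M_is_borel _ gap] by (auto simp: M_is_borel)
  then have "AE y in \<mu>. y \<notin> {\<alpha><..<\<beta>}" by (rule AE_not_in)
  then have AE: "AE y in \<mu>. ennreal (w m powr s) * riesz_kernel s m y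
    \<le> ennreal (w \<alpha> powr s / 2) * riesz_kernel s \<alpha> y + ennreal (w \<beta> powr s / 2) * riesz_kernel s \<beta> y"
    unfolding m_def by eventually_elim (auto intro!: kernel_midpt less)
  have int: "ennreal (w m powr s) * potential \<mu> m
    \<le> ennreal (w \<alpha> powr s / 2) * potential \<mu> \<alpha> + ennreal (w \<beta> powr s / 2) * potential \<mu> \<beta>"
    unfolding potential_def using nn_integral_mono_AE[OF AE]
    by (simp add: nn_integral_add nn_integral_cmult)
  \<comment> \<open>The upper condition also shows that the potential is finite at the ends of the
    gap, so that the comparison can be made in the reals.\<close>
  have fin: "\<exists>u\<ge>0. potential \<mu> x = ennreal u \<and> w x powr s * (u + f) \<le> q" if "x \<in> measure_support \<mu>" for x
  proof -
    have "potential \<mu> x \<noteq> \<infinity>" using le[OF that] by (auto simp: top_unique)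
    then obtain u where u: "0 \<le> u" "potential \<mu> x = ennreal u" by (cases "potential \<mu> x") auto
    then have "u + f \<le> q * w x powr (- s)"
      using le[OF that] f(2) q_pos by (simp add: ennreal_plus[symmetric] del: ennreal_plus)
    then have "w x powr s * (u + f) \<le> w x powr s * (q * w x powr (- s))" by (intro mult_left_mono) auto
    also have "\<dots> = q" using w_pos[of x] by (simp add: powr_minus)
    finally show ?thesis using u by blast
  qed
  obtain u v where u: "0 \<le> u" "potential \<mu> \<alpha> = ennreal u" "w \<alpha> powr s * (u + f) \<le> q"
    and v: "0 \<le> v" "potential \<mu> \<beta> = ennreal v" "w \<beta> powr s * (v + f) \<le> q"
    using fin supp by meson
  have int': "ennreal (w m powr s) * potential \<mu> m \<le> ennreal (w \<alpha> powr s / 2 * u + w \<beta> powr s / 2 * v)"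
    using int u(1) v(1) unfolding u(2) v(2) by (simp add: ennreal_mult[symmetric])
  have "potential \<mu> m \<noteq> \<infinity>"
    using int' w_pos[of m] by (auto simp: ennreal_mult_top top_unique)
  then obtain t where t: "0 \<le> t" "potential \<mu> m = ennreal t" by (cases "potential \<mu> m") auto
  have 1: "w m powr s * t \<le> w \<alpha> powr s / 2 * u + w \<beta> powr s / 2 * v"
    using int' t u v by (simp add: ennreal_mult[symmetric] ennreal_plus[symmetric] del: ennreal_plus)
  have "q * w m powr (- s) \<le> t + f"
    using ge[OF m] t f(2) by (simp add: ennreal_plus[symmetric] del: ennreal_plus)
  then have "w m powr s * (q * w m powr (- s)) \<le> w m powr s * (t + f)" by (intro mult_left_mono) auto
  also have "w m powr s * (q * w m powr (- s)) = q" using w_pos[of m] by (simp add: powr_minus)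
  finally have 2: "q \<le> w m powr s * (t + f)" .
  have 3: "w m powr s < (w \<alpha> powr s + w \<beta> powr s) / 2"
  proof (rule power2_less_imp_less)
    have "((w m)\<^sup>2) powr s < (w \<alpha> * w \<beta>) powr s"
      using w_midpt_less[OF less] s_pos by (intro powr_less_mono2) (auto simp: m_def)
    then have "(w m powr s)\<^sup>2 < w \<alpha> powr s * w \<beta> powr s"
      using w_nonneg by (simp add: power2_eq_square powr_mult)
    also have "\<dots> \<le> ((w \<alpha> powr s + w \<beta> powr s) / 2)\<^sup>2"
      using zero_le_power2[of "w \<alpha> powr s - w \<beta> powr s"] by (simp add: power2_eq_square field_simps)
    finally show "(w m powr s)\<^sup>2 < ((w \<alpha> powr s + w \<beta> powr s) / 2)\<^sup>2" .
  qed simp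
  then have "w m powr s * f < (w \<alpha> powr s + w \<beta> powr s) / 2 * f" using f(2) by simp
  with 1 2 u(3) v(3) show False by (simp add: algebra_simps)
qed

text \<open>The potential is nonnegative, so on the support \<open>f\<close> is at most
  \<open>q * w x powr (- s)\<close>, which bounds the distance to \<open>z\<close>.\<close>

lemma support_bounded:
  assumes q: "1 < q" and \<mu>: "equilibrium \<mu>"
  shows "bounded (measure_support \<mu>)"
proof -
  define f where "f = - frostman \<mu>"
  have f: "frostman \<mu> = - f" "0 < f" using frostman_neg[OF q \<mu>] by (auto simp: f_def)
  have "\<bar>x - Re z\<bar> \<le> (q / f) powr (1 / s)" if x: "x \<in> measure_support \<mu>" for x
  proof -
    have "ennreal f \<le> ennreal (q * w x powr (- s))"
      using potential_le_on_support[OF \<mu> f x] by (rule order_trans[rotated]) simp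
    then have "f \<le> q * w x powr (- s)" using q_pos by simp
    then have "w x powr s \<le> q / f" using f(2) w_pos[of x] by (simp add: powr_minus field_simps)
    then have "(w x powr s) powr (1 / s) \<le> (q / f) powr (1 / s)"
      using s_pos by (intro powr_mono2) auto
    then show ?thesis using w_ge(1)[of x] w_pos[of x] s_pos by (simp add: powr_powr)
  qed
  then show ?thesis
    unfolding bounded_def by (intro exI[of _ "Re z"] exI[of _ "(q / f) powr (1 / s)"])
      (auto simp: dist_real_def abs_minus_commute)
qed

lemma support_interval:
  assumes q: "1 < q" and \<mu>: "equilibrium \<mu>"
  shows "\<exists>a b. a \<le> b \<and> measure_support \<mu> = {a..b}"
proof (rule gap_free_imp_interval)
  interpret finite_borel_measure \<mu> by (rule equilibrium_finite_borel[OF \<mu>])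
  show "closed (measure_support \<mu>)" by (rule measure_support_closed[OF M_is_borel])
  show "bounded (measure_support \<mu>)" by (rule support_bounded[OF q \<mu>])
  show "measure_support \<mu> \<noteq> {}"
    using emeasure_open_disjoint_support[OF M_is_borel, of UNIV] equilibrium_mass[OF \<mu>] by (auto simp: emeasure_eq_measure)
qed (rule support_no_gap[OF q \<mu>])

end

theorem theorem2p1:
  fixes s q :: real and z :: complex
  assumes "0 < s" and "s < 1" and "0 < q" and "Im z \<noteq> 0"
  shows "(q > 1 \<longrightarrow>
            (\<exists>!\<mu>. is_equilibrium_measure s (field_Q s q z) \<mu>) \<and>
            (\<forall>\<mu>. is_equilibrium_measure s (field_Q s q z) \<mu> \<longrightarrow>
                 (\<exists>a b. a \<le> b \<and> measure_support \<mu> = {a..b})))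
       \<and> (q < 1 \<longrightarrow> \<not> (\<exists>\<mu>. is_equilibrium_measure s (field_Q s q z) \<mu>))"
proof -
  interpret riesz_field_strength s z q
    using assms by unfold_locales
  show ?thesis
    unfolding is_equilibrium_measure_iff
    using equilibrium_exists equilibrium_unique support_interval no_equilibrium by blast
qed

end
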